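(* Let $R$ be a commutative ring in which $2$ is invertible, and let $Q$ be a finite quiver with double $\overline{Q}$. Let $\mathcal{N}$ be the free $R$-module on cyclic paths in $\overline{Q}$, and define $\mathrm{br}^+:\mathcal{N}\otimes\mathcal{N}\to\mathcal{N}$ and $\delta^+:\mathcal{N}\to\mathcal{N}\otimes\mathcal{N}$ by $$\mathrm{br}^+(a_1\cdots a_m\otimes b_1\cdots b_n)=\sum_{i=1}^m\sum_{j=1}^n\langle a_i,b_j\rangle\,a_ia_{i+1}\cdots a_{i-1}a_i\,b_jb_{j+1}\cdots b_{j-1}b_j,$$ $$\delta^+(a_1\cdots a_n)=\frac12\sum_{i,j=1}^n\langle a_i,a_j\rangle\,a_ia_{i+1}\cdots a_{j-1}a_j\otimes a_ja_{j+1}\cdots a_{i-1}a_i,$$ both vanishing on constant paths. Then $(\mathcal{N},\mathrm{br}^+,\delta^+)$ is an involutive Lie bialgebra.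
   Context: The double $\overline{Q}$ of $Q=(s,t:Q_1\to Q_0)$ has the same vertices and arrows $Q_1\sqcup\{\overline{a}\mid a\in Q_1\}$, with $s(\overline{a})=t(a)$, $t(\overline{a})=s(a)$. The pairing on arrows is $\langle a,b\rangle=1$ if $a\in Q_1$, $b=\overline{a}$; $-1$ if $b\in Q_1$, $a=\overline{b}$; $0$ otherwise. Paths are words $a_1\cdots a_n$ of arrows with $t(a_k)=s(a_{k+1})$, together with a constant path $e_i$ for each vertex; a cyclic path is a closed path up to rotation (including the $e_i$). Equivalently $\mathcal{N}=R\overline{Q}/[R\overline{Q},R\overline{Q}]$ with $R\overline{Q}$ the path algebra. Indices are read cyclically: $a_ia_{i+1}\cdots a_{i-1}a_i$ is the full rotation of the word starting at $a_i$ followed by one more copy of $a_i$; $a_ia_{i+1}\cdots a_{j-1}a_j$ is the cyclic subword from position $i$ to position $j$. An involutive Lie bialgebra is $(\mathfrak{g},\mathrm{br},\delta)$ with $\mathrm{br}$ a Lie bracket, $\delta$ a Lie cobracket (antisymmetric and coJacobi), $\delta$ a 1-cocycle: $\delta(\mathrm{br}(x\otimes y))=x\cdot\delta(y)-y\cdot\delta(x)$ for the adjoint action on $\mathfrak{g}\otimes\mathfrak{g}$, and $\mathrm{br}\circ\delta=0$. *)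

theory Defs
  imports "HOL-Library.Poly_Mapping" "Graph_Theory.Arc_Walk"
begin

section \<open>Free modules and their tensor products\<close>

text \<open>
  The type \<open>'b \<Rightarrow>\<^sub>0 'r\<close> is the free \<open>'r\<close>-module on \<open>'b\<close>, with basis elements
  \<open>Poly_Mapping.single b 1\<close>; the free module on a set \<open>B\<close> is its submodule \<open>free_on B\<close>.
  The tensor product of the free modules on \<open>A\<close> and \<open>B\<close> is the free module on \<open>A \<times> B\<close>,
  with pure tensors \<open>x \<otimes> y\<close> as below (see \<open>tensor_universal\<close>).
\<close>

definition scale :: "'r::comm_ring_1 \<Rightarrow> ('b \<Rightarrow>\<^sub>0 'r) \<Rightarrow> ('b \<Rightarrow>\<^sub>0 'r)" where
  "scale c x = Poly_Mapping.map ((*) c) x"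

definition free_on :: "'b set \<Rightarrow> ('b \<Rightarrow>\<^sub>0 'r::comm_ring_1) set" where
  "free_on B = {x. Poly_Mapping.keys x \<subseteq> B}"

definition linear_map_on ::
  "('b \<Rightarrow>\<^sub>0 'r::comm_ring_1) set \<Rightarrow> ('c \<Rightarrow>\<^sub>0 'r) set \<Rightarrow> (('b \<Rightarrow>\<^sub>0 'r) \<Rightarrow> ('c \<Rightarrow>\<^sub>0 'r)) \<Rightarrow> bool" where
  "linear_map_on M N f \<longleftrightarrow>
     (\<forall>x\<in>M. f x \<in> N) \<and>
     (\<forall>x\<in>M. \<forall>y\<in>M. f (x + y) = f x + f y) \<and>
     (\<forall>c. \<forall>x\<in>M. f (scale c x) = scale c (f x))"

definition lin_ext :: "('b \<Rightarrow> ('c \<Rightarrow>\<^sub>0 'r::comm_ring_1)) \<Rightarrow> ('b \<Rightarrow>\<^sub>0 'r) \<Rightarrow> ('c \<Rightarrow>\<^sub>0 'r)" where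
  "lin_ext f x = (\<Sum>b\<in>Poly_Mapping.keys x. scale (Poly_Mapping.lookup x b) (f b))"

definition tensor :: "('b \<Rightarrow>\<^sub>0 'r::comm_ring_1) \<Rightarrow> ('c \<Rightarrow>\<^sub>0 'r) \<Rightarrow> ('b \<times> 'c \<Rightarrow>\<^sub>0 'r)"
    (infixr "\<otimes>" 75) where
  "x \<otimes> y = (\<Sum>b\<in>Poly_Mapping.keys x. \<Sum>c\<in>Poly_Mapping.keys y.
     Poly_Mapping.single (b, c) (Poly_Mapping.lookup x b * Poly_Mapping.lookup y c))"

definition tensor_map ::
  "(('b \<Rightarrow>\<^sub>0 'r::comm_ring_1) \<Rightarrow> ('c \<Rightarrow>\<^sub>0 'r)) \<Rightarrow> (('d \<Rightarrow>\<^sub>0 'r) \<Rightarrow> ('e \<Rightarrow>\<^sub>0 'r)) \<Rightarrow>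
     ('b \<times> 'd \<Rightarrow>\<^sub>0 'r) \<Rightarrow> ('c \<times> 'e \<Rightarrow>\<^sub>0 'r)" where
  "tensor_map f g = lin_ext (\<lambda>(b, d). f (Poly_Mapping.single b 1) \<otimes> g (Poly_Mapping.single d 1))"

definition tensor_swap :: "('b \<times> 'b \<Rightarrow>\<^sub>0 'r::comm_ring_1) \<Rightarrow> ('b \<times> 'b \<Rightarrow>\<^sub>0 'r)" where
  "tensor_swap = lin_ext (\<lambda>(a, b). Poly_Mapping.single (b, a) 1)"

definition tensor_cycle :: "('b \<times> 'b \<times> 'b \<Rightarrow>\<^sub>0 'r::comm_ring_1) \<Rightarrow> ('b \<times> 'b \<times> 'b \<Rightarrow>\<^sub>0 'r)" where
  "tensor_cycle = lin_ext (\<lambda>(a, b, c). Poly_Mapping.single (b, c, a) 1)"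

lemma lookup_scale [simp]: "Poly_Mapping.lookup (scale c x) b = c * Poly_Mapping.lookup x b"
  by (simp add: scale_def Poly_Mapping.map.rep_eq when_def)

lemma lookup_lin_ext:
  "Poly_Mapping.lookup (lin_ext f x) c =
     (\<Sum>b\<in>Poly_Mapping.keys x. Poly_Mapping.lookup x b * Poly_Mapping.lookup (f b) c)"
  by (simp add: lin_ext_def lookup_sum)

lemma lookup_tensor [simp]:
  "Poly_Mapping.lookup (x \<otimes> y) (b, c) = Poly_Mapping.lookup x b * Poly_Mapping.lookup y c"
proof -
  have "Poly_Mapping.lookup (x \<otimes> y) (b, c) =
    (\<Sum>b'\<in>Poly_Mapping.keys x. \<Sum>c'\<in>Poly_Mapping.keys y.
       if c' = c then (if b' = b then Poly_Mapping.lookup x b' * Poly_Mapping.lookup y c' else 0) else 0)"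
    unfolding tensor_def lookup_sum by (intro sum.cong refl) (auto simp: lookup_single when_def)
  also have "\<dots> = (\<Sum>b'\<in>Poly_Mapping.keys x.
       if b' = b then Poly_Mapping.lookup x b' * Poly_Mapping.lookup y c else 0)"
    by (intro sum.cong refl) (auto simp: in_keys_iff)
  also have "\<dots> = Poly_Mapping.lookup x b * Poly_Mapping.lookup y c"
    by (auto simp: in_keys_iff)
  finally show ?thesis .
qed

lemma lin_ext_superset:
  assumes "finite S" "Poly_Mapping.keys x \<subseteq> S"
  shows "lin_ext f x = (\<Sum>b\<in>S. scale (Poly_Mapping.lookup x b) (f b))"
  unfolding lin_ext_def
proof (rule sum.mono_neutral_left[OF assms])
  show "\<forall>i\<in>S - Poly_Mapping.keys x. scale (Poly_Mapping.lookup x i) (f i) = 0"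
    by (auto simp: in_keys_iff intro!: poly_mapping_eqI)
qed

lemma lin_ext_add: "lin_ext f (x + y) = lin_ext f x + lin_ext f y"
proof -
  let ?S = "Poly_Mapping.keys x \<union> Poly_Mapping.keys y"
  have "Poly_Mapping.keys (x + y) \<subseteq> ?S" by (rule Poly_Mapping.keys_add)
  then show ?thesis
    by (subst (1 2 3) lin_ext_superset[of ?S])
       (auto simp: lookup_add lookup_sum sum.distrib algebra_simps intro!: poly_mapping_eqI)
qed

lemma lin_ext_scale: "lin_ext f (scale c x) = scale c (lin_ext f x)"
proof -
  have "Poly_Mapping.keys (scale c x) \<subseteq> Poly_Mapping.keys x"
    by (auto simp: in_keys_iff)
  then show ?thesis
    by (subst lin_ext_superset[of "Poly_Mapping.keys x"])
       (auto simp: lookup_lin_ext lookup_sum sum_distrib_left mult.assoc intro!: poly_mapping_eqI)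
qed

lemma lin_ext_single [simp]: "lin_ext f (Poly_Mapping.single b 1) = f b"
  by (rule poly_mapping_eqI) (simp add: lookup_lin_ext)

lemma linear_map_sum:
  assumes "linear_map_on UNIV UNIV h" "finite S"
  shows "h (\<Sum>b\<in>S. scale (c b) (f b)) = (\<Sum>b\<in>S. scale (c b) (h (f b)))"
  using assms(2)
proof (induction S rule: finite_induct)
  case empty
  have "h (0 + 0) = h 0 + h 0" using assms(1) unfolding linear_map_on_def by blast
  then show ?case by simp
next
  case (insert b S)
  then show ?case using assms(1) by (simp add: linear_map_on_def)
qed

lemma lin_ext_basis: "lin_ext (\<lambda>b. Poly_Mapping.single b 1) x = x"
  by (rule poly_mapping_eqI)
     (auto simp: lookup_lin_ext lookup_single when_def in_keys_iff sum.delta' if_distrib cong: if_cong)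

lemma linear_map_eq_lin_ext:
  assumes "linear_map_on UNIV UNIV h"
  shows "h x = lin_ext (\<lambda>b. h (Poly_Mapping.single b 1)) x"
  using linear_map_sum[OF assms, of "Poly_Mapping.keys x" "Poly_Mapping.lookup x"
      "\<lambda>b. Poly_Mapping.single b 1"] lin_ext_basis[of x]
  by (simp add: lin_ext_def)

lemma tensor_universal:
  fixes g :: "('b \<Rightarrow>\<^sub>0 'r::comm_ring_1) \<Rightarrow> ('c \<Rightarrow>\<^sub>0 'r) \<Rightarrow> ('d \<Rightarrow>\<^sub>0 'r)"
  assumes "\<And>y. linear_map_on UNIV UNIV (\<lambda>x. g x y)" "\<And>x. linear_map_on UNIV UNIV (g x)"
  shows "\<exists>!h. linear_map_on UNIV UNIV h \<and> (\<forall>x y. h (x \<otimes> y) = g x y)"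
proof (rule ex1I, intro conjI allI)
  let ?h = "lin_ext (\<lambda>(b, c). g (Poly_Mapping.single b 1) (Poly_Mapping.single c 1))"
  show "linear_map_on UNIV UNIV ?h"
    by (simp add: linear_map_on_def lin_ext_add lin_ext_scale)
  fix x :: "'b \<Rightarrow>\<^sub>0 'r" and y :: "'c \<Rightarrow>\<^sub>0 'r"
  have keys: "Poly_Mapping.keys (x \<otimes> y) \<subseteq> Poly_Mapping.keys x \<times> Poly_Mapping.keys y"
    by (auto simp: in_keys_iff)
  have "g x y = lin_ext (\<lambda>b. lin_ext (\<lambda>c. g (Poly_Mapping.single b 1) (Poly_Mapping.single c 1)) y) x"
    by (subst linear_map_eq_lin_ext[OF assms(1)], subst linear_map_eq_lin_ext[OF assms(2)]) (rule refl)
  also have "\<dots> = ?h (x \<otimes> y)"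
    by (subst lin_ext_superset[OF _ keys])
       (auto simp: sum.cartesian_product lookup_lin_ext lookup_sum sum_distrib_left
          mult.assoc intro!: poly_mapping_eqI sum.cong)
  finally show "?h (x \<otimes> y) = g x y" by simp
next
  fix h assume h: "linear_map_on UNIV UNIV h \<and> (\<forall>x y. h (x \<otimes> y) = g x y)"
  have pure: "Poly_Mapping.single (b, c) 1 = Poly_Mapping.single b 1 \<otimes> Poly_Mapping.single c (1::'r)"
    for b :: 'b and c :: 'c
  proof (rule poly_mapping_eqI)
    fix k :: "'b \<times> 'c"
    obtain b' c' where k: "k = (b', c')" by (cases k)
    show "Poly_Mapping.lookup (Poly_Mapping.single (b, c) 1) k =
        Poly_Mapping.lookup (Poly_Mapping.single b 1 \<otimes> Poly_Mapping.single c (1::'r)) k"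
      unfolding k lookup_tensor by (simp add: lookup_single when_def)
  qed
  have eq: "(\<lambda>z. h (Poly_Mapping.single z 1)) =
      (\<lambda>(b, c). g (Poly_Mapping.single b 1) (Poly_Mapping.single c 1))"
  proof
    fix z :: "'b \<times> 'c"
    obtain b c where z: "z = (b, c)" by (cases z)
    show "h (Poly_Mapping.single z 1) =
        (case z of (b, c) \<Rightarrow> g (Poly_Mapping.single b 1) (Poly_Mapping.single c 1))"
      unfolding z pure prod.case using h by blast
  qed
  show "h = lin_ext (\<lambda>(b, c). g (Poly_Mapping.single b 1) (Poly_Mapping.single c 1))"
    unfolding eq[symmetric] by (rule ext) (rule linear_map_eq_lin_ext[OF conjunct1[OF h]])
qed


section \<open>Involutive Lie bialgebras\<close>

text \<open>
  The underlying module is the free module on \<open>B\<close>.  The bracket and the cobracket are functions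
  on the ambient types; all conditions concern their restrictions to \<open>free_on B\<close>,
  \<open>free_on (B \<times> B)\<close> and \<open>free_on (B \<times> B \<times> B)\<close>.
\<close>

locale lie_algebra_on =
  fixes B :: "'b set" and br :: "('b \<times> 'b \<Rightarrow>\<^sub>0 'r::comm_ring_1) \<Rightarrow> ('b \<Rightarrow>\<^sub>0 'r)"
  assumes br_linear: "linear_map_on (free_on (B \<times> B)) (free_on B) br"
    and br_alternating: "x \<in> free_on B \<Longrightarrow> br (x \<otimes> x) = 0"
    and br_jacobi: "\<lbrakk>x \<in> free_on B; y \<in> free_on B; z \<in> free_on B\<rbrakk> \<Longrightarrow>
      br (x \<otimes> br (y \<otimes> z)) + br (y \<otimes> br (z \<otimes> x)) + br (z \<otimes> br (x \<otimes> y)) = 0"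

locale lie_coalgebra_on =
  fixes B :: "'b set" and \<delta> :: "('b \<Rightarrow>\<^sub>0 'r::comm_ring_1) \<Rightarrow> ('b \<times> 'b \<Rightarrow>\<^sub>0 'r)"
  assumes cobr_linear: "linear_map_on (free_on B) (free_on (B \<times> B)) \<delta>"
    and cobr_antisym: "x \<in> free_on B \<Longrightarrow> tensor_swap (\<delta> x) = - \<delta> x"
    and cobr_cojacobi: "x \<in> free_on B \<Longrightarrow>
      tensor_map id \<delta> (\<delta> x) + tensor_cycle (tensor_map id \<delta> (\<delta> x))
        + tensor_cycle (tensor_cycle (tensor_map id \<delta> (\<delta> x))) = 0"

definition adjoint_action ::
  "(('b \<times> 'b \<Rightarrow>\<^sub>0 'r::comm_ring_1) \<Rightarrow> ('b \<Rightarrow>\<^sub>0 'r)) \<Rightarrow> ('b \<Rightarrow>\<^sub>0 'r) \<Rightarrow>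
     ('b \<times> 'b \<Rightarrow>\<^sub>0 'r) \<Rightarrow> ('b \<times> 'b \<Rightarrow>\<^sub>0 'r)" where
  "adjoint_action br x t =
     tensor_map (\<lambda>u. br (x \<otimes> u)) id t + tensor_map id (\<lambda>v. br (x \<otimes> v)) t"

locale lie_bialgebra_on = lie_algebra_on B br + lie_coalgebra_on B \<delta>
  for B :: "'b set" and br :: "('b \<times> 'b \<Rightarrow>\<^sub>0 'r::comm_ring_1) \<Rightarrow> ('b \<Rightarrow>\<^sub>0 'r)"
    and \<delta> :: "('b \<Rightarrow>\<^sub>0 'r) \<Rightarrow> ('b \<times> 'b \<Rightarrow>\<^sub>0 'r)" +
  assumes cocycle: "\<lbrakk>x \<in> free_on B; y \<in> free_on B\<rbrakk> \<Longrightarrow>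
    \<delta> (br (x \<otimes> y)) = adjoint_action br x (\<delta> y) - adjoint_action br y (\<delta> x)"

locale involutive_lie_bialgebra_on = lie_bialgebra_on B br \<delta>
  for B :: "'b set" and br :: "('b \<times> 'b \<Rightarrow>\<^sub>0 'r::comm_ring_1) \<Rightarrow> ('b \<Rightarrow>\<^sub>0 'r)"
    and \<delta> :: "('b \<Rightarrow>\<^sub>0 'r) \<Rightarrow> ('b \<times> 'b \<Rightarrow>\<^sub>0 'r)" +
  assumes involutive: "x \<in> free_on B \<Longrightarrow> br (\<delta> x) = 0"


section \<open>The double quiver and its cyclic paths\<close>

text \<open>
  A quiver is a \<open>wf_digraph\<close> (parallel arcs and loops are allowed), with \<open>s = tail\<close> and
  \<open>t = head\<close>; in the double, \<open>Inl a\<close> is the arrow \<open>a\<close> and \<open>Inr a\<close> is its reverse.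
\<close>

definition double :: "('v, 'e) pre_digraph \<Rightarrow> ('v, 'e + 'e) pre_digraph" where
  "double Q = \<lparr> verts = verts Q, arcs = arcs Q <+> arcs Q,
     tail = case_sum (tail Q) (head Q), head = case_sum (head Q) (tail Q) \<rparr>"

fun pairing :: "'e + 'e \<Rightarrow> 'e + 'e \<Rightarrow> 'r::comm_ring_1" where
  "pairing (Inl a) (Inr b) = (if a = b then 1 else 0)"
| "pairing (Inr a) (Inl b) = (if a = b then - 1 else 0)"
| "pairing (Inl a) (Inl b) = 0"
| "pairing (Inr a) (Inr b) = 0"

definition rot_equiv :: "'c list \<Rightarrow> 'c list \<Rightarrow> bool" where
  "rot_equiv p q \<longleftrightarrow> (\<exists>k. q = rotate k p)"

lemma equivp_rot_equiv: "equivp rot_equiv"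
proof (rule equivpI)
  show "reflp rot_equiv"
    unfolding reflp_def rot_equiv_def by (metis rotate0 id_apply)
  show "symp rot_equiv"
  proof (rule sympI, unfold rot_equiv_def, elim exE)
    fix p q :: "'c list" and k assume "q = rotate k p"
    moreover have "rotate (length p - k mod length p) (rotate (k mod length p) p) = p"
      by (cases "p = []") (simp_all add: rotate_rotate)
    ultimately show "\<exists>k. p = rotate k q" by (metis rotate_conv_mod)
  qed
  show "transp rot_equiv"
    unfolding transp_def rot_equiv_def by (auto simp: rotate_rotate)
qed

quotient_type 'c cyclic_word = "'c list" / rot_equiv
  by (rule equivp_rot_equiv)

text \<open>
  \<open>Const i\<close> is the constant path at the vertex \<open>i\<close>, and \<open>Cyc w\<close> the cyclic path with
  (nonempty) word \<open>w\<close>.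
\<close>
datatype ('v, 'c) cyclic_path = Const 'v | Cyc "'c cyclic_word"

definition cyclic_paths :: "('v, 'c) pre_digraph \<Rightarrow> ('v, 'c) cyclic_path set" where
  "cyclic_paths G = Const ` verts G \<union>
     {Cyc (abs_cyclic_word p) | p u. p \<noteq> [] \<and> pre_digraph.awalk G u p u}"


section \<open>The bracket and the cobracket\<close>

text \<open>
  Positions are counted from \<open>0\<close>: \<open>full_turn p i\<close> is the word \<open>a\<^sub>i a\<^sub>i\<^sub>+\<^sub>1 \<dots> a\<^sub>i\<^sub>-\<^sub>1 a\<^sub>i\<close> and
  \<open>arc_word p i j\<close> is the word \<open>a\<^sub>i a\<^sub>i\<^sub>+\<^sub>1 \<dots> a\<^sub>j\<^sub>-\<^sub>1 a\<^sub>j\<close>.  (For \<open>i = j\<close> the latter is taken to be the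
  one-letter word; this case never matters, since \<open>pairing a a = 0\<close>.)
\<close>

definition full_turn :: "'c list \<Rightarrow> nat \<Rightarrow> 'c list" where
  "full_turn p i = rotate i p @ [p ! i]"

definition arc_word :: "'c list \<Rightarrow> nat \<Rightarrow> nat \<Rightarrow> 'c list" where
  "arc_word p i j = take (Suc ((j + length p - i) mod length p)) (rotate i p)"

definition br_word ::
  "('e + 'e) list \<Rightarrow> ('e + 'e) list \<Rightarrow> (('v, 'e + 'e) cyclic_path \<Rightarrow>\<^sub>0 'r::comm_ring_1)" where
  "br_word p q = (\<Sum>i<length p. \<Sum>j<length q.
     Poly_Mapping.single (Cyc (abs_cyclic_word (full_turn p i @ full_turn q j))) (pairing (p ! i) (q ! j)))"

definition half :: "'r::comm_ring_1" where
  "half = (THE h. 2 * h = 1)"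

lemma two_half:
  assumes "(2::'r::comm_ring_1) dvd 1"
  shows "2 * (half :: 'r) = 1"
proof -
  obtain h :: 'r where h: "2 * h = 1" using assms by (metis dvd_def)
  have "h' = h" if "2 * h' = 1" for h'
    using that h by (metis mult.assoc mult.commute mult_1)
  then show ?thesis unfolding half_def using h by (rule_tac theI) auto
qed

definition cobr_word ::
  "('e + 'e) list \<Rightarrow> (('v, 'e + 'e) cyclic_path \<times> ('v, 'e + 'e) cyclic_path \<Rightarrow>\<^sub>0 'r::comm_ring_1)" where
  "cobr_word p = scale half (\<Sum>i<length p. \<Sum>j<length p.
     Poly_Mapping.single (Cyc (abs_cyclic_word (arc_word p i j)), Cyc (abs_cyclic_word (arc_word p j i)))
       (pairing (p ! i) (p ! j)))"

lemma bij_betw_rotate_index: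
  assumes "0 < (n::nat)"
  shows "bij_betw (\<lambda>i. (k + i) mod n) {..<n} {..<n}"
proof -
  have "inj_on (\<lambda>i. (k + i) mod n) {..<n}"
  proof (rule inj_onI)
    fix x y assume *: "x \<in> {..<n}" "y \<in> {..<n}" "(k + x) mod n = (k + y) mod n"
    have "(int k + int x) mod int n = (int k + int y) mod int n"
      using *(3) by (metis of_nat_add of_nat_mod)
    then have "int x mod int n = int y mod int n"
      by (metis add_diff_cancel_left' mod_diff_left_eq)
    then show "x = y" using *(1,2) by simp
  qed
  moreover have "(\<lambda>i. (k + i) mod n) ` {..<n} \<subseteq> {..<n}" using assms by auto
  ultimately show ?thesis
    by (simp add: bij_betw_def card_image card_subset_eq)
qed

lemma full_turn_rotate:
  assumes "i < length p"
  shows "full_turn (rotate k p) i = full_turn p ((k + i) mod length p)"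
proof -
  have "rotate i (rotate k p) = rotate ((k + i) mod length p) p"
    by (metis rotate_rotate rotate_conv_mod add.commute)
  then show ?thesis using assms by (simp add: full_turn_def nth_rotate)
qed

lemma arc_word_rotate:
  assumes "i < length p" "j < length p"
  shows "arc_word (rotate k p) i j = arc_word p ((k + i) mod length p) ((k + j) mod length p)"
proof -
  let ?n = "length p"
  have r: "rotate i (rotate k p) = rotate ((k + i) mod ?n) p"
    by (metis rotate_rotate rotate_conv_mod add.commute)
  have n: "(k + i) mod ?n < ?n" using assms by (intro mod_less_divisor) auto
  have "int ((j + ?n - i) mod ?n) = (int j - int i) mod int ?n"
  proof -
    have "int (j + ?n - i) = (int j - int i) + int ?n" using assms by simp
    then show ?thesis by (simp only: of_nat_mod mod_add_self2)
  qed
  also have "\<dots> = ((int k + int j) mod int ?n - (int k + int i) mod int ?n) mod int ?n"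
    by (simp add: mod_diff_eq)
  also have "\<dots> = int (((k + j) mod ?n + ?n - (k + i) mod ?n) mod ?n)"
  proof -
    have "int ((k + j) mod ?n + ?n - (k + i) mod ?n)
        = ((int k + int j) mod int ?n - (int k + int i) mod int ?n) + int ?n"
      using n by (simp add: of_nat_mod of_nat_diff)
    then show ?thesis by (simp only: of_nat_mod mod_add_self2)
  qed
  finally have "(j + ?n - i) mod ?n = ((k + j) mod ?n + ?n - (k + i) mod ?n) mod ?n"
    by simp
  with r show ?thesis by (simp add: arc_word_def)
qed

lemma sum_rotate_index: "(\<Sum>i<n. f ((k + i) mod n)) = (\<Sum>i<n::nat. f i)"
  by (cases "n = 0") (auto intro: sum.reindex_bij_betw bij_betw_rotate_index)

lemma br_word_rotate: "br_word (rotate k p) (rotate l q) = br_word p q"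
proof -
  let ?f = "\<lambda>i j. Poly_Mapping.single (Cyc (abs_cyclic_word (full_turn p i @ full_turn q j)))
    (pairing (p ! i) (q ! j))"
  have "br_word (rotate k p) (rotate l q) =
      (\<Sum>i<length p. \<Sum>j<length q. ?f ((k + i) mod length p) ((l + j) mod length q))"
    unfolding br_word_def by (auto simp: full_turn_rotate nth_rotate intro!: sum.cong)
  also have "\<dots> = (\<Sum>i<length p. \<Sum>j<length q. ?f ((k + i) mod length p) j)"
    by (rule sum.cong[OF refl]) (rule sum_rotate_index)
  also have "\<dots> = (\<Sum>i<length p. \<Sum>j<length q. ?f i j)"
    by (rule sum_rotate_index)
  finally show ?thesis by (simp add: br_word_def)
qed

lemma cobr_word_rotate: "cobr_word (rotate k p) = cobr_word p"
proof -
  let ?f = "\<lambda>i j. Poly_Mapping.single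
    (Cyc (abs_cyclic_word (arc_word p i j)), Cyc (abs_cyclic_word (arc_word p j i)))
    (pairing (p ! i) (p ! j))"
  have "cobr_word (rotate k p) =
      scale half (\<Sum>i<length p. \<Sum>j<length p. ?f ((k + i) mod length p) ((k + j) mod length p))"
    unfolding cobr_word_def
    by (auto simp: arc_word_rotate nth_rotate intro!: sum.cong arg_cong[where f = "scale half"])
  also have "(\<Sum>i<length p. \<Sum>j<length p. ?f ((k + i) mod length p) ((k + j) mod length p)) =
      (\<Sum>i<length p. \<Sum>j<length p. ?f ((k + i) mod length p) j)"
    by (rule sum.cong[OF refl]) (rule sum_rotate_index)
  also have "\<dots> = (\<Sum>i<length p. \<Sum>j<length p. ?f i j)"
    by (rule sum_rotate_index)
  finally show ?thesis by (simp add: cobr_word_def)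
qed

lift_definition br_cyclic_word ::
  "('e + 'e) cyclic_word \<Rightarrow> ('e + 'e) cyclic_word \<Rightarrow> (('v, 'e + 'e) cyclic_path \<Rightarrow>\<^sub>0 'r::comm_ring_1)"
  is br_word
  by (auto simp: rot_equiv_def br_word_rotate)

lift_definition cobr_cyclic_word ::
  "('e + 'e) cyclic_word \<Rightarrow>
     (('v, 'e + 'e) cyclic_path \<times> ('v, 'e + 'e) cyclic_path \<Rightarrow>\<^sub>0 'r::comm_ring_1)"
  is cobr_word
  by (auto simp: rot_equiv_def cobr_word_rotate)

definition br_plus ::
  "(('v, 'e + 'e) cyclic_path \<times> ('v, 'e + 'e) cyclic_path \<Rightarrow>\<^sub>0 'r::comm_ring_1) \<Rightarrow>
     (('v, 'e + 'e) cyclic_path \<Rightarrow>\<^sub>0 'r)" where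
  "br_plus = lin_ext (\<lambda>z. case z of (Cyc v, Cyc w) \<Rightarrow> br_cyclic_word v w | _ \<Rightarrow> 0)"

definition cobr_plus ::
  "(('v, 'e + 'e) cyclic_path \<Rightarrow>\<^sub>0 'r::comm_ring_1) \<Rightarrow>
     (('v, 'e + 'e) cyclic_path \<times> ('v, 'e + 'e) cyclic_path \<Rightarrow>\<^sub>0 'r)" where
  "cobr_plus = lin_ext (\<lambda>z. case z of Cyc w \<Rightarrow> cobr_cyclic_word w | Const _ \<Rightarrow> 0)"

end

theory Submission
  imports Defs
begin

text \<open>
  Dually, the bracket and the cobracket act on functions of cyclic words, and each axiom becomes an
  identity between sums over tuples of positions in words.  Both operations double the two paired
  letters and reconnect the word there, so after one operation a further pairing
  involves either two untouched letters, or one or both of the doubled ones.  In each case the same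
  words arise with the opposite sign from another choice of positions, up to rotation.  Invertibility
  of 2 serves to conclude that a sum which equals its own negative vanishes.
  Nothing but the antisymmetry of the pairing and \<open>\<langle>a, a\<rangle> = 0\<close> enters; composability of paths
  matters only for seeing that the operations preserve cyclic paths.
\<close>

section \<open>Sums over positions in cyclic words\<close>

text \<open>Recursion on the word lets \<open>simp\<close> evaluate such sums on words built with
  \<open>#\<close> and \<open>@\<close>, the form in which the output of one operation reaches the
  next.\<close>

primrec split_sum :: "'a list \<Rightarrow> ('a list \<Rightarrow> 'a \<Rightarrow> 'a list \<Rightarrow> 'm::comm_monoid_add) \<Rightarrow> 'm" where
  "split_sum [] f = 0"
| "split_sum (a # w) f = f [] a w + split_sum w (\<lambda>u. f (a # u))"

lemma split_sum_append [simp]: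
  "split_sum (u @ v) f =
     split_sum u (\<lambda>u1 a u2. f u1 a (u2 @ v)) + split_sum v (\<lambda>v1 a v2. f (u @ v1) a v2)"
  by (induction u arbitrary: f) (simp_all add: add.assoc)

lemma split_sum_zero [simp]: "split_sum w (\<lambda>_ _ _. 0) = 0"
  by (induction w) simp_all

lemma split_sum_add:
  "split_sum w (\<lambda>u a v. f u a v + g u a v) = split_sum w f + split_sum w g"
  by (induction w arbitrary: f g) (simp_all add: add_ac)

lemma split_sum_minus:
  fixes f :: "_ \<Rightarrow> _ \<Rightarrow> _ \<Rightarrow> 'm::ab_group_add"
  shows "split_sum w (\<lambda>u a v. - f u a v) = - split_sum w f"
  by (induction w arbitrary: f) simp_all

lemma split_sum_diff:
  fixes f :: "_ \<Rightarrow> _ \<Rightarrow> _ \<Rightarrow> 'm::ab_group_add"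
  shows "split_sum w (\<lambda>u a v. f u a v - g u a v) = split_sum w f - split_sum w g"
  by (induction w arbitrary: f g) simp_all

lemma split_sum_mult:
  fixes f :: "_ \<Rightarrow> _ \<Rightarrow> _ \<Rightarrow> 'm::semiring_0"
  shows "split_sum w (\<lambda>u a v. c * f u a v) = c * split_sum w f"
  by (induction w arbitrary: f) (simp_all add: distrib_left)

lemma split_sum_swap:
  "split_sum w (\<lambda>u a v. split_sum w' (\<lambda>u' a' v'. f u a v u' a' v'))
     = split_sum w' (\<lambda>u' a' v'. split_sum w (\<lambda>u a v. f u a v u' a' v'))"
  by (induction w arbitrary: f) (simp_all add: split_sum_add)

text \<open>Both sides run over the pairs with \<open>a\<close> before \<open>b\<close>; only the
  order of choice differs.\<close>

lemma split_sum_nested: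
  "split_sum w (\<lambda>u b v. split_sum u (\<lambda>u1 a u2. f u1 a u2 b v))
     = split_sum w (\<lambda>u a v. split_sum v (\<lambda>v1 b v2. f u a v1 b v2))"
  by (induction w arbitrary: f) (simp_all add: split_sum_add)

lemma split_sum_hom:
  assumes "h 0 = 0" "\<And>x y. h (x + y) = h x + h y"
  shows "h (split_sum w f) = split_sum w (\<lambda>u a v. h (f u a v))"
  by (induction w arbitrary: f) (simp_all add: assms)

text \<open>The equation \<open>w = u @ a # v\<close> is kept because composability of the pieces is
  read off from it in the closure proofs.\<close>

lemma split_sum_induct:
  assumes "P 0" "\<And>x y. P x \<Longrightarrow> P y \<Longrightarrow> P (x + y)"
    and "\<And>u a v. w = u @ a # v \<Longrightarrow> P (f u a v)"
  shows "P (split_sum w f)"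
  using assms(3)
proof (induction w arbitrary: f)
  case (Cons a w)
  have "P (f [] a w)" by (rule Cons.prems) simp
  moreover have "P (split_sum w (\<lambda>u. f (a # u)))"
    by (rule Cons.IH) (rule Cons.prems, simp)
  ultimately show ?case by (simp add: assms(2))
qed (simp add: assms(1))

lemma split_sum_conv_nth:
  "split_sum w f = (\<Sum>i<length w. f (take i w) (w ! i) (drop (Suc i) w))"
  by (induction w arbitrary: f)
     (simp_all add: sum.lessThan_Suc_shift del: sum.lessThan_Suc)

text \<open>
  \<open>cyc_sum2\<close>, \<open>cyc_sum3\<close>, \<open>cyc_sum4\<close> sum over the choices of 2, 3, 4 distinct positions of a cyclic
  word, one of them distinguished as the first: \<open>a X b Y \<dots>\<close> is the rotation that starts at the
  distinguished position, and \<open>a, b, \<dots>\<close> are the letters at the chosen ones.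
\<close>

definition cyc_sum :: "'a list \<Rightarrow> ('a \<Rightarrow> 'a list \<Rightarrow> 'm::comm_monoid_add) \<Rightarrow> 'm" where
  "cyc_sum p f = split_sum p (\<lambda>u a v. f a (v @ u))"

definition cyc_sum2 :: "'a list \<Rightarrow> ('a \<Rightarrow> 'a list \<Rightarrow> 'a \<Rightarrow> 'a list \<Rightarrow> 'm::comm_monoid_add) \<Rightarrow> 'm" where
  "cyc_sum2 p f = cyc_sum p (\<lambda>a X. split_sum X (\<lambda>X b Y. f a X b Y))"

definition cyc_sum3 ::
  "'a list \<Rightarrow> ('a \<Rightarrow> 'a list \<Rightarrow> 'a \<Rightarrow> 'a list \<Rightarrow> 'a \<Rightarrow> 'a list \<Rightarrow> 'm::comm_monoid_add) \<Rightarrow> 'm" where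
  "cyc_sum3 p f = cyc_sum2 p (\<lambda>a X b Y. split_sum Y (\<lambda>Y c Z. f a X b Y c Z))"

definition cyc_sum4 ::
  "'a list \<Rightarrow> ('a \<Rightarrow> 'a list \<Rightarrow> 'a \<Rightarrow> 'a list \<Rightarrow> 'a \<Rightarrow> 'a list \<Rightarrow> 'a \<Rightarrow> 'a list \<Rightarrow>
     'm::comm_monoid_add) \<Rightarrow> 'm" where
  "cyc_sum4 p f = cyc_sum3 p (\<lambda>a X b Y c Z. split_sum Z (\<lambda>Z d W. f a X b Y c Z d W))"

lemmas cyc_sum_defs = cyc_sum_def cyc_sum2_def cyc_sum3_def cyc_sum4_def

lemma cyc_sum_congs:
  "(\<And>u a v. f1 u a v = g1 u a v) \<Longrightarrow> split_sum p f1 = split_sum p g1"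
  "(\<And>a X. f2 a X = g2 a X) \<Longrightarrow> cyc_sum p f2 = cyc_sum p g2"
  "(\<And>a X b Y. f3 a X b Y = g3 a X b Y) \<Longrightarrow> cyc_sum2 p f3 = cyc_sum2 p g3"
  "(\<And>a X b Y c Z. f4 a X b Y c Z = g4 a X b Y c Z) \<Longrightarrow> cyc_sum3 p f4 = cyc_sum3 p g4"
  "(\<And>a X b Y c Z d W. f5 a X b Y c Z d W = g5 a X b Y c Z d W)
    \<Longrightarrow> cyc_sum4 p f5 = cyc_sum4 p g5"
  by (auto intro!: arg_cong[where f = "split_sum p"] arg_cong[where f = "cyc_sum p"]
      arg_cong[where f = "cyc_sum2 p"] arg_cong[where f = "cyc_sum3 p"] arg_cong[where f = "cyc_sum4 p"] ext)

lemma cyc_sum_Cons: "cyc_sum (a # w) f = f a w + split_sum w (\<lambda>u b v. f b (v @ a # u))"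
  by (simp add: cyc_sum_def)

lemma cyc_sum_zero [simp]: "cyc_sum p (\<lambda>_ _. 0) = 0"
  by (simp add: cyc_sum_def)

section \<open>Linearity and interchange of cyclic sums\<close>

lemma cyc_sum_add: "cyc_sum p (\<lambda>a X. f a X + g a X) = cyc_sum p f + cyc_sum p g"
  by (simp add: cyc_sum_def split_sum_add)

lemma cyc_sum_minus:
  fixes f :: "_ \<Rightarrow> _ \<Rightarrow> 'm::ab_group_add"
  shows "cyc_sum p (\<lambda>a X. - f a X) = - cyc_sum p f"
  by (simp add: cyc_sum_def split_sum_minus)

lemma cyc_sum_diff:
  fixes f :: "_ \<Rightarrow> _ \<Rightarrow> 'm::ab_group_add"
  shows "cyc_sum p (\<lambda>a X. f a X - g a X) = cyc_sum p f - cyc_sum p g"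
  by (simp add: cyc_sum_def split_sum_diff)

lemma cyc_sum_mult:
  fixes f :: "_ \<Rightarrow> _ \<Rightarrow> 'm::semiring_0"
  shows "cyc_sum p (\<lambda>a X. c * f a X) = c * cyc_sum p f"
  by (simp add: cyc_sum_def split_sum_mult)

lemma cyc_sum_swap:
  "cyc_sum p (\<lambda>a X. cyc_sum q (\<lambda>b Y. f a X b Y)) = cyc_sum q (\<lambda>b Y. cyc_sum p (\<lambda>a X. f a X b Y))"
  unfolding cyc_sum_def by (rule split_sum_swap)

lemma cyc_sum_split_swap:
  "cyc_sum p (\<lambda>a X. split_sum w (\<lambda>u b v. f a X u b v))
    = split_sum w (\<lambda>u b v. cyc_sum p (\<lambda>a X. f a X u b v))"
  unfolding cyc_sum_def by (rule split_sum_swap)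

lemma cyc_sum2_zero [simp]: "cyc_sum2 p (\<lambda>_ _ _ _. 0) = 0"
  by (simp add: cyc_sum2_def)

lemma cyc_sum2_add:
  "cyc_sum2 p (\<lambda>a X b Y. f a X b Y + g a X b Y) = cyc_sum2 p f + cyc_sum2 p g"
  by (simp add: cyc_sum2_def cyc_sum_add split_sum_add)

lemma cyc_sum2_minus:
  fixes f :: "_ \<Rightarrow> _ \<Rightarrow> _ \<Rightarrow> _ \<Rightarrow> 'm::ab_group_add"
  shows "cyc_sum2 p (\<lambda>a X b Y. - f a X b Y) = - cyc_sum2 p f"
  by (simp add: cyc_sum2_def cyc_sum_minus split_sum_minus)

lemma cyc_sum2_mult:
  fixes f :: "_ \<Rightarrow> _ \<Rightarrow> _ \<Rightarrow> _ \<Rightarrow> 'm::semiring_0"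
  shows "cyc_sum2 p (\<lambda>a X b Y. c * f a X b Y) = c * cyc_sum2 p f"
  by (simp add: cyc_sum2_def cyc_sum_mult split_sum_mult)

lemma cyc_sum3_minus:
  fixes f :: "_ \<Rightarrow> _ \<Rightarrow> _ \<Rightarrow> _ \<Rightarrow> _ \<Rightarrow> _ \<Rightarrow> 'm::ab_group_add"
  shows "cyc_sum3 p (\<lambda>a X b Y c Z. - f a X b Y c Z) = - cyc_sum3 p f"
  by (simp add: cyc_sum3_def cyc_sum2_minus split_sum_minus)

lemma cyc_sum4_minus:
  fixes f :: "_ \<Rightarrow> _ \<Rightarrow> _ \<Rightarrow> _ \<Rightarrow> _ \<Rightarrow> _ \<Rightarrow> _ \<Rightarrow> _ \<Rightarrow> 'm::ab_group_add"
  shows "cyc_sum4 p (\<lambda>a X b Y c Z d W. - f a X b Y c Z d W) = - cyc_sum4 p f"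
  by (simp add: cyc_sum4_def cyc_sum3_minus split_sum_minus)

lemma cyc_sum2_swap:
  "cyc_sum p (\<lambda>a X. cyc_sum2 q (\<lambda>b Y c Z. f a X b Y c Z))
    = cyc_sum2 q (\<lambda>b Y c Z. cyc_sum p (\<lambda>a X. f a X b Y c Z))"
  unfolding cyc_sum2_def by (simp add: cyc_sum_split_swap cyc_sum_swap[of p q])

text \<open>Either chosen position may be called the first: splitting \<open>v @ u\<close> produces
  every pair of positions in both roles.\<close>

lemma cyc_sum2_rotate: "cyc_sum2 p f = cyc_sum2 p (\<lambda>a X b Y. f b Y a X)"
  by (simp add: cyc_sum_defs split_sum_add add.commute
      split_sum_nested[symmetric, of p "\<lambda>u a v1 b v2. f a v1 b (v2 @ u)"]
      split_sum_nested[symmetric, of p "\<lambda>u a v1 b v2. f b (v2 @ u) a v1"])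

text \<open>The distinction passes to the second position. After \<open>cyc_sum2_rotate\<close> the
  third position lies in the arc behind the new first one, and \<open>split_sum_nested\<close>
  restores the order.\<close>

lemma cyc_sum3_rotate: "cyc_sum3 p f = cyc_sum3 p (\<lambda>a X b Y c Z. f c Z a X b Y)"
  unfolding cyc_sum3_def
  by (subst cyc_sum2_rotate) (simp add: cyc_sum2_def split_sum_nested)

lemma cyc_sum4_rotate: "cyc_sum4 p f = cyc_sum4 p (\<lambda>a X b Y c Z d W. f d W a X b Y c Z)"
  unfolding cyc_sum4_def
  by (subst cyc_sum3_rotate) (simp add: cyc_sum3_def split_sum_nested)

lemma cyc_sum3_nested:
  "cyc_sum2 p (\<lambda>a X c Z. split_sum X (\<lambda>X b Y. f a X b Y c Z)) = cyc_sum3 p f"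
  by (simp add: cyc_sum3_def cyc_sum2_def split_sum_nested)

text \<open>Four positions arise this way when a word is cut at \<open>a\<close> and
  \<open>c\<close> and one more letter is chosen in each piece.\<close>

lemma cyc_sum4_nested:
  "cyc_sum2 p (\<lambda>a X c Z. split_sum X (\<lambda>X b Y. split_sum Z (\<lambda>Z d W. f a X b Y c Z d W)))
    = cyc_sum4 p f"
  unfolding cyc_sum4_def cyc_sum3_nested[symmetric] ..

text \<open>Meant for words with explicit end letters: each unordered pair of positions is visited
  once and contributes in both orders.\<close>

lemma cyc_sum2_ordered:
  "cyc_sum2 w h = split_sum w (\<lambda>u d v. split_sum v (\<lambda>V e W. h d V e (W @ u) + h e (W @ u) d V))"
  by (simp add: cyc_sum_defs split_sum_add split_sum_nested)

section \<open>The axioms as identities between sums over words\<close>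

text \<open>Phrased by exchanging two pieces rather than by \<open>rotate\<close>, since each use
  names the place where the word is cut.\<close>

definition cyc_invariant :: "('a list \<Rightarrow> 'b) \<Rightarrow> bool" where
  "cyc_invariant t \<longleftrightarrow> (\<forall>u v. t (u @ v) = t (v @ u))"

lemma cyc_invariantD: "cyc_invariant t \<Longrightarrow> t (u @ v) = t (v @ u)"
  by (simp add: cyc_invariant_def)

section \<open>Transposed operations for an abstract alternating pairing\<close>

locale alternating_pairing =
  fixes g :: "'c \<Rightarrow> 'c \<Rightarrow> 'r::comm_ring_1"
  assumes alt: "g a a = 0" and antisym: "g a b = - g b a"
begin

text \<open>The transposed bracket: \<open>t\<close> is a functional given by its values on words,
  and this is its value on the bracket of \<open>p\<close> and \<open>q\<close>.\<close>

definition br_sum :: "('c list \<Rightarrow> 'r) \<Rightarrow> 'c list \<Rightarrow> 'c list \<Rightarrow> 'r" where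
  "br_sum t p q =
     cyc_sum p (\<lambda>a X. cyc_sum q (\<lambda>b Y. g a b * t (a # X @ a # b # Y @ [b])))"

text \<open>The transposed cobracket without the factor 1/2, which returns in
  \<open>cobr_dual_simps\<close>.\<close>

definition cobr_sum :: "('c list \<Rightarrow> 'c list \<Rightarrow> 'r) \<Rightarrow> 'c list \<Rightarrow> 'r" where
  "cobr_sum t p = cyc_sum2 p (\<lambda>a X b Y. g a b * t (a # X @ [b]) (b # Y @ [a]))"

lemma br_sum_zero [simp]: "br_sum (\<lambda>_. 0) p q = 0"
  by (simp add: br_sum_def)

lemma cobr_sum_zero [simp]: "cobr_sum (\<lambda>_ _. 0) p = 0"
  by (simp add: cobr_sum_def)

lemma br_sum_mult: "br_sum (\<lambda>w. c * t w) p q = c * br_sum t p q"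
  by (simp add: br_sum_def mult.left_commute[of _ c] cyc_sum_mult)

lemma cobr_sum_mult: "cobr_sum (\<lambda>u v. c * t u v) p = c * cobr_sum t p"
  by (simp add: cobr_sum_def mult.left_commute[of _ c] cyc_sum2_mult)

text \<open>A rotation exchanges the full turns at \<open>a\<close> and \<open>b\<close>; the
  pairing supplies the sign.\<close>

lemma br_sum_antisym:
  assumes "cyc_invariant t"
  shows "br_sum t p q = - br_sum t q p"
proof -
  have "g a b * t (a # X @ a # b # Y @ [b]) = - (g b a * t (b # Y @ b # a # X @ [a]))" for a X b Y
    using cyc_invariantD[OF assms, of "a # X @ [a]" "b # Y @ [b]"] antisym[of b a] by simp
  then have "br_sum t p q
      = cyc_sum p (\<lambda>a X. cyc_sum q (\<lambda>b Y. - (g b a * t (b # Y @ b # a # X @ [a]))))"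
    unfolding br_sum_def by (intro cyc_sum_congs)
  also have "\<dots> = - br_sum t q p"
    unfolding br_sum_def cyc_sum_swap[of p q] cyc_sum_minus ..
  finally show ?thesis .
qed

lemma cobr_sum_antisym: "cobr_sum (\<lambda>u v. t v u) p = - cobr_sum t p"
  unfolding cobr_sum_def
  by (subst cyc_sum2_rotate, subst antisym) (simp add: cyc_sum2_minus)

text \<open>The letter \<open>a\<close> of \<open>x\<close> pairs either with one of the copies of
  the doubled letters in the bracket of \<open>y\<close> and \<open>z\<close> (\<open>P\<close>,
  \<open>P'\<close>) or with an undoubled letter (\<open>S\<close>). The symmetries
  \<open>P' x y z = P z y x\<close> and \<open>S x y z = S z y x\<close> make the cyclic sum
  cancel.\<close>

lemma br_sum_jacobi:
  assumes t: "cyc_invariant t"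
  shows "br_sum (br_sum t x) y z + br_sum (br_sum t y) z x + br_sum (br_sum t z) x y = 0"
proof -
  define P where "P x y z = cyc_sum x (\<lambda>a X. cyc_sum y (\<lambda>b Y. cyc_sum z (\<lambda>c Z.
    g b c * g a b * t (a # X @ a # b # Y @ b # c # Z @ [c, b]))))" for x y z
  define P' where "P' x y z = cyc_sum x (\<lambda>a X. cyc_sum y (\<lambda>b Y. cyc_sum z (\<lambda>c Z.
    g b c * g a b * t (a # X @ a # b # c # Z @ c # b # Y @ [b]))))" for x y z
  define S where "S x y z = cyc_sum x (\<lambda>a X. cyc_sum2 y (\<lambda>b Y p Y'. cyc_sum z (\<lambda>c Z.
    g b c * g a p * t (a # X @ a # p # Y' @ b # c # Z @ c # b # Y @ [p]))))" for x y z
  have expand: "br_sum (br_sum t x) y z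
      = P x y z + P' x y z - P x z y - P' x z y + S x y z - S x z y" for x y z
  proof -
    \<comment> \<open>The letters of \<open>b Y b c Z c\<close> in turn: two copies of
      \<open>b\<close>, two of \<open>c\<close>, then those inside \<open>Y\<close> and
      \<open>Z\<close>. Terms at \<open>c\<close> or in \<open>Z\<close> get their sign from
      \<open>g b c = - g c b\<close>.\<close>
    have expand1: "g b c * cyc_sum (b # Y @ b # c # Z @ [c]) (\<lambda>d W. g a d * t (a # X @ a # d # W @ [d]))
      = g b c * g a b * t (a # X @ a # b # Y @ b # c # Z @ [c, b])
        + g b c * g a b * t (a # X @ a # b # c # Z @ c # b # Y @ [b])
        + - (g c b * g a c * t (a # X @ a # c # Z @ c # b # Y @ [b, c]))
        + - (g c b * g a c * t (a # X @ a # c # b # Y @ b # c # Z @ [c]))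
        + split_sum Y (\<lambda>Y p Y'.
            g b c * g a p * t (a # X @ a # p # Y' @ b # c # Z @ c # b # Y @ [p]))
        + - split_sum Z (\<lambda>Z p Z'.
            g c b * g a p * t (a # X @ a # p # Z' @ c # b # Y @ b # c # Z @ [p]))" for a X b Y c Z
      by (simp add: cyc_sum_Cons split_sum_mult split_sum_minus mult.assoc antisym[of c b],
          simp add: algebra_simps)
    have "br_sum (br_sum t x) y z = cyc_sum x (\<lambda>a X. cyc_sum y (\<lambda>b Y. cyc_sum z (\<lambda>c Z.
        g b c * cyc_sum (b # Y @ b # c # Z @ [c]) (\<lambda>d W. g a d * t (a # X @ a # d # W @ [d])))))"
      unfolding br_sum_def cyc_sum_mult[symmetric] cyc_sum_swap[of z x] cyc_sum_swap[of y x] by simp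
    also have "\<dots> = P x y z + P' x y z - P x z y - P' x z y + S x y z - S x z y"
      unfolding expand1 cyc_sum_add cyc_sum_minus P_def P'_def S_def cyc_sum2_def
        cyc_sum_split_swap[symmetric] cyc_sum_swap[of z y]
      by simp
    finally show ?thesis .
  qed
  have P: "P' x y z = P z y x" for x y z
  proof -
    have "g b c * g a b * t (a # X @ a # b # c # Z @ c # b # Y @ [b])
        = g b a * g c b * t (c # Z @ c # b # Y @ b # a # X @ [a, b])" for a X b Y c Z
      using cyc_invariantD[OF t, of "c # Z @ c # b # Y @ [b]" "a # X @ [a, b]"]
        antisym[of b c] antisym[of b a] by simp
    then show ?thesis
      unfolding P_def P'_def cyc_sum_swap[of x] cyc_sum_swap[of y z] by simp
  qed
  \<comment> \<open>The word \<open>y\<close> carries both pairings, \<open>b\<close> with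
    \<open>c\<close> and \<open>p\<close> with \<open>a\<close>; reading the configuration from
    \<open>z\<close> exchanges its two letters.\<close>
  have S: "S x y z = S z y x" for x y z
  proof -
    have "g p c * g a b * t (a # X @ a # b # Y @ p # c # Z @ c # p # Y' @ [b])
        = g b a * g c p * t (c # Z @ c # p # Y' @ b # a # X @ a # b # Y @ [p])" for a X b Y c Z p Y'
      using cyc_invariantD[OF t, of "a # X @ a # b # Y @ [p]" "c # Z @ c # p # Y' @ [b]"]
        antisym[of p c] antisym[of b a] by simp
    then show ?thesis
      unfolding S_def cyc_sum2_swap cyc_sum_swap[of x z]
      by (subst cyc_sum2_rotate) (intro cyc_sum_congs)
  qed
  show ?thesis
    unfolding expand P S[of y z x] S[of z x y] S[of x y z] by simp
qed

text \<open>The word is cut at one pair of letters and rejoined at another; exchanging the two pairs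
  gives the same word up to rotation and the opposite sign. So \<open>A1\<close> cancels
  \<open>A4\<close> and \<open>A2\<close> cancels \<open>A3\<close>, but \<open>A5\<close> is its
  own partner, which yields only \<open>A5 = - A5\<close> and explains the factor 2.\<close>

lemma br_cobr_sum:
  assumes t: "cyc_invariant t"
  shows "2 * cobr_sum (br_sum t) x = 0"
proof -
  define A1 where "A1 = cyc_sum3 x (\<lambda>a X b Y c Z.
    g a b * g a c * t (a # X @ b # a # c # Z @ a # b # Y @ [c]))"
  define A2 where "A2 = cyc_sum3 x (\<lambda>a X b Y c Z.
    g a b * g b c * t (b # a # X @ b # c # Z @ a # b # Y @ [c]))"
  define A3 where "A3 = cyc_sum3 x (\<lambda>a X b Y c Z.
    g a c * g b c * t (b # Y @ c # a # X @ b # c # Z @ [a, c]))"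
  define A4 where "A4 = cyc_sum3 x (\<lambda>a X b Y c Z.
    g a c * g b a * t (b # Y @ c # a # X @ b # a # c # Z @ [a]))"
  define A5 where "A5 = cyc_sum4 x (\<lambda>a X b Y c Z d W.
    g a c * g b d * t (b # Y @ c # a # X @ b # d # W @ a # c # Z @ [d]))"
  \<comment> \<open>Both pieces contain \<open>a\<close> and \<open>b\<close>. Pairing
    \<open>a\<close> with \<open>a\<close> or \<open>b\<close> with \<open>b\<close> gives 0; the
    terms for \<open>a\<close> with \<open>b\<close> and \<open>b\<close> with \<open>a\<close>
    cancel after rotation by one letter.\<close>
  have expand1: "g a b * br_sum t (a # X @ [b]) (b # Y @ [a])
      = split_sum Y (\<lambda>Y q Y'. g a b * g a q * t (a # X @ b # a # q # Y' @ a # b # Y @ [q]))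
      + split_sum Y (\<lambda>Y q Y'. g a b * g b q * t (b # a # X @ b # q # Y' @ a # b # Y @ [q]))
      + split_sum X (\<lambda>X p X'. g a b * g p b * t (p # X' @ b # a # X @ p # b # Y @ [a, b]))
      + split_sum X (\<lambda>X p X'. g a b * g p a * t (p # X' @ b # a # X @ p # a # b # Y @ [a]))
      + split_sum X (\<lambda>X p X'. split_sum Y (\<lambda>Y q Y'.
          g a b * g p q * t (p # X' @ b # a # X @ p # q # Y' @ a # b # Y @ [q])))" for a X b Y
    using cyc_invariantD[OF t, of "a # X @ b # a # b # Y @ [a]" "[b]"]
    by (simp add: br_sum_def cyc_sum_Cons split_sum_mult split_sum_add mult.assoc alt antisym[of b a],
        simp add: algebra_simps)
  have "cobr_sum (br_sum t) x = A1 + A2 + A3 + A4 + A5"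
    unfolding cobr_sum_def expand1 cyc_sum2_add cyc_sum4_nested
    unfolding cyc_sum3_nested A1_def A2_def A3_def A4_def A5_def
    by (simp add: cyc_sum3_def)
  moreover have "A4 = - A1"
    unfolding A1_def A4_def cyc_sum3_minus[symmetric]
  proof (intro cyc_sum_congs)
    fix a X b Y c Z
    show "g a c * g b a * t (b # Y @ c # a # X @ b # a # c # Z @ [a])
      = - (g a b * g a c * t (a # X @ b # a # c # Z @ a # b # Y @ [c]))"
      using cyc_invariantD[OF t, of "b # Y @ [c]" "a # X @ b # a # c # Z @ [a]"] antisym[of b a]
      by simp
  qed
  moreover have "A3 = - A2"
    unfolding A2_def A3_def cyc_sum3_minus[symmetric]
  proof (subst cyc_sum3_rotate, intro cyc_sum_congs)
    fix a X b Y c Z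
    show "g c b * g a b * t (a # X @ b # c # Z @ a # b # Y @ [c, b])
      = - (g a b * g b c * t (b # a # X @ b # c # Z @ a # b # Y @ [c]))"
      using cyc_invariantD[OF t, of "a # X @ b # c # Z @ a # b # Y @ [c]" "[b]"] antisym[of c b]
      by simp
  qed
  moreover have "A5 = - A5"
  proof -
    have "A5 = - cyc_sum4 x (\<lambda>a X b Y c Z d W.
      g a c * g b d * t (b # Y @ c # a # X @ b # d # W @ a # c # Z @ [d]))"
      unfolding A5_def cyc_sum4_minus[symmetric]
    \<comment> \<open>One shift exchanges the crossing pairs \<open>a, c\<close> and
      \<open>b, d\<close>, reversing one of them.\<close>
    proof (subst cyc_sum4_rotate, intro cyc_sum_congs)
      fix a X b Y c Z d W
      show "g d b * g a c * t (a # X @ b # d # W @ a # c # Z @ d # b # Y @ [c])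
        = - (g a c * g b d * t (b # Y @ c # a # X @ b # d # W @ a # c # Z @ [d]))"
        using cyc_invariantD[OF t, of "a # X @ b # d # W @ a # c # Z @ [d]" "b # Y @ [c]"]
          antisym[of d b] by simp
    qed
    then show ?thesis by (simp only: A5_def)
  qed
  then have "2 * A5 = 0" by (metis add.right_inverse mult_2)
  ultimately show ?thesis by simp
qed

text \<open>The second cut meets \<open>b Y a\<close> at both ends (\<open>K1\<close>,
  \<open>K2\<close>), at one end and inside (\<open>K3\<close> to \<open>K6\<close>), or twice
  inside (\<open>K7\<close>, \<open>K8\<close>). Exchanging the two cuts gives the same three words
  up to rotation, permutes them cyclically and changes the sign.\<close>

lemma cobr_sum_cojacobi:
  assumes t1: "\<And>v w. cyc_invariant (\<lambda>u. t u v w)"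
    and t2: "\<And>u w. cyc_invariant (\<lambda>v. t u v w)"
    and t3: "\<And>u v. cyc_invariant (\<lambda>w. t u v w)"
  shows "cobr_sum (\<lambda>u. cobr_sum (\<lambda>v w. t u v w)) p + cobr_sum (\<lambda>u. cobr_sum (\<lambda>v w. t v w u)) p
    + cobr_sum (\<lambda>u. cobr_sum (\<lambda>v w. t w u v)) p = 0"
proof -
  define K1 where "K1 t = cyc_sum2 p (\<lambda>a X b Y.
    g a b * g b a * t (a # X @ [b]) (b # Y @ [a]) [a, b])" for t :: "_ \<Rightarrow> _ \<Rightarrow> _ \<Rightarrow> 'r"
  define K2 where "K2 t = cyc_sum2 p (\<lambda>a X b Y.
    g a b * g a b * t (a # X @ [b]) [a, b] (b # Y @ [a]))" for t :: "_ \<Rightarrow> _ \<Rightarrow> _ \<Rightarrow> 'r"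
  define K3 where "K3 t = cyc_sum3 p (\<lambda>a X b Y c Z.
    g a b * g b c * t (a # X @ [b]) (b # Y @ [c]) (c # Z @ [a, b]))" for t :: "_ \<Rightarrow> _ \<Rightarrow> _ \<Rightarrow> 'r"
  define K4 where "K4 t = cyc_sum3 p (\<lambda>a X b Y c Z.
    g a b * g c b * t (a # X @ [b]) (c # Z @ [a, b]) (b # Y @ [c]))" for t :: "_ \<Rightarrow> _ \<Rightarrow> _ \<Rightarrow> 'r"
  define K5 where "K5 t = cyc_sum3 p (\<lambda>a X b Y c Z.
    g a b * g c a * t (a # X @ [b]) (c # Z @ [a]) (a # b # Y @ [c]))" for t :: "_ \<Rightarrow> _ \<Rightarrow> _ \<Rightarrow> 'r"
  define K6 where "K6 t = cyc_sum3 p (\<lambda>a X b Y c Z.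
    g a b * g a c * t (a # X @ [b]) (a # b # Y @ [c]) (c # Z @ [a]))" for t :: "_ \<Rightarrow> _ \<Rightarrow> _ \<Rightarrow> 'r"
  define K7 where "K7 t = cyc_sum4 p (\<lambda>a X b Y c Z d W.
    g a b * g c d * t (a # X @ [b]) (c # Z @ [d]) (d # W @ a # b # Y @ [c]))" for t :: "_ \<Rightarrow> _ \<Rightarrow> _ \<Rightarrow> 'r"
  define K8 where "K8 t = cyc_sum4 p (\<lambda>a X b Y c Z d W.
    g a b * g d c * t (a # X @ [b]) (d # W @ a # b # Y @ [c]) (c # Z @ [d]))" for t :: "_ \<Rightarrow> _ \<Rightarrow> _ \<Rightarrow> 'r"
  have expand1: "g a b * cobr_sum (t (a # X @ [b])) (b # Y @ [a])
     = g a b * g b a * t (a # X @ [b]) (b # Y @ [a]) [a, b]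
     + g a b * g a b * t (a # X @ [b]) [a, b] (b # Y @ [a])
     + split_sum Y (\<lambda>Y c Z. g a b * g b c * t (a # X @ [b]) (b # Y @ [c]) (c # Z @ [a, b]))
     + split_sum Y (\<lambda>Y c Z. g a b * g c b * t (a # X @ [b]) (c # Z @ [a, b]) (b # Y @ [c]))
     + split_sum Y (\<lambda>Y c Z. g a b * g c a * t (a # X @ [b]) (c # Z @ [a]) (a # b # Y @ [c]))
     + split_sum Y (\<lambda>Y c Z. g a b * g a c * t (a # X @ [b]) (a # b # Y @ [c]) (c # Z @ [a]))
     + split_sum Y (\<lambda>Y c Z. split_sum Z (\<lambda>Z d W.
         g a b * g c d * t (a # X @ [b]) (c # Z @ [d]) (d # W @ a # b # Y @ [c])))
     + split_sum Y (\<lambda>Y c Z. split_sum Z (\<lambda>Z d W.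
         g a b * g d c * t (a # X @ [b]) (d # W @ a # b # Y @ [c]) (c # Z @ [d])))"
    for a X b Y and t :: "'c list \<Rightarrow> 'c list \<Rightarrow> 'c list \<Rightarrow> 'r"
    unfolding cobr_sum_def cyc_sum2_ordered
    by (simp add: split_sum_mult split_sum_add mult.assoc, simp add: algebra_simps)
  have expand: "cobr_sum (\<lambda>u. cobr_sum (t u)) p
    = K1 t + K2 t + K3 t + K4 t + K5 t + K6 t + K7 t + K8 t" for t
    unfolding cobr_sum_def[of _ p] expand1 cyc_sum2_add K1_def K2_def K3_def K4_def K5_def
      K6_def K7_def K8_def cyc_sum4_def cyc_sum3_def ..
  \<comment> \<open>Stated for every invariant \<open>t\<close>: applied to the given functional and
    its two cyclic rearrangements, the four identities pair off all 24 terms.\<close>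
  have K: "K2 (\<lambda>u v w. t w u v) = - K1 t" "K4 (\<lambda>u v w. t w u v) = - K5 t"
    "K6 (\<lambda>u v w. t w u v) = - K3 t" "K8 (\<lambda>u v w. t w u v) = - K7 t"
    if t1: "\<And>v w. cyc_invariant (\<lambda>u. t u v w)" and t2: "\<And>u w. cyc_invariant (\<lambda>v. t u v w)"
      and t3: "\<And>u v. cyc_invariant (\<lambda>w. t u v w)" for t
  proof -
    note t = cyc_invariantD[OF t1] cyc_invariantD[OF t2] cyc_invariantD[OF t3]
    show "K2 (\<lambda>u v w. t w u v) = - K1 t"
      unfolding K1_def K2_def cyc_sum2_minus[symmetric]
    proof (subst cyc_sum2_rotate, intro cyc_sum_congs)
      fix a X b Y
      show "g b a * g b a * t (a # X @ [b]) (b # Y @ [a]) [b, a]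
        = - (g a b * g b a * t (a # X @ [b]) (b # Y @ [a]) [a, b])"
        using t(3)[of _ _ "[a]" "[b]"] antisym[of b a] by simp
    qed
    show "K4 (\<lambda>u v w. t w u v) = - K5 t"
      unfolding K4_def K5_def cyc_sum3_minus[symmetric]
    proof (subst cyc_sum3_rotate, intro cyc_sum_congs)
      fix a X b Y c Z
      show "g c a * g b a * t (a # X @ [b]) (c # Z @ [a]) (b # Y @ [c, a])
        = - (g a b * g c a * t (a # X @ [b]) (c # Z @ [a]) (a # b # Y @ [c]))"
        using t(3)[of _ _ "[a]" "b # Y @ [c]"] antisym[of b a] by simp
    qed
    have "K3 t = - K6 (\<lambda>u v w. t w u v)"
      unfolding K3_def K6_def cyc_sum3_minus[symmetric]
    proof (subst cyc_sum3_rotate, intro cyc_sum_congs)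
      fix a X b Y c Z
      show "g c a * g a b * t (c # Z @ [a]) (a # X @ [b]) (b # Y @ [c, a])
        = - (g a b * g a c * t (c # Z @ [a]) (a # X @ [b]) (a # b # Y @ [c]))"
        using t(3)[of _ _ "[a]" "b # Y @ [c]"] antisym[of c a] by simp
    qed
    then show "K6 (\<lambda>u v w. t w u v) = - K3 t" by simp
    show "K8 (\<lambda>u v w. t w u v) = - K7 t"
      unfolding K7_def K8_def cyc_sum4_minus[symmetric]
    \<comment> \<open>Two shifts exchange the pairs \<open>a, b\<close> and
      \<open>c, d\<close>.\<close>
    proof (subst cyc_sum4_rotate, subst cyc_sum4_rotate, intro cyc_sum_congs)
      fix a X b Y c Z d W
      show "g c d * g b a * t (a # X @ [b]) (c # Z @ [d]) (b # Y @ c # d # W @ [a])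
        = - (g a b * g c d * t (a # X @ [b]) (c # Z @ [d]) (d # W @ a # b # Y @ [c]))"
        using t(3)[of _ _ "d # W @ [a]" "b # Y @ [c]"] antisym[of b a] by simp
    qed
  qed
  show ?thesis
    unfolding expand
    using K[of t, OF t1 t2 t3] K[of "\<lambda>u v w. t w u v", OF t2 t3 t1]
      K[of "\<lambda>u v w. t v w u", OF t3 t1 t2]
    by simp
qed

text \<open>The cobracket cuts the word \<open>a X a b Y b\<close> at two letters. Cuts at two
  doubled letters cancel or vanish (\<open>k1\<close>, \<open>k2\<close>, \<open>k_self\<close>),
  and cuts at one letter of \<open>X\<close> and one of \<open>Y\<close> cancel in total
  (\<open>M\<close>). In the rest, \<open>R\<close> and its mirror image, the terms joining a letter
  of \<open>X\<close> to \<open>b\<close> cancel and the others give the action of \<open>y\<close>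
  on the cobracket of \<open>x\<close>.\<close>

lemma cobr_br_sum:
  assumes t1: "\<And>v. cyc_invariant (\<lambda>u. t u v)" and t2: "\<And>u. cyc_invariant (\<lambda>v. t u v)"
  shows "br_sum (cobr_sum t) x y
    = cobr_sum (\<lambda>u v. br_sum (\<lambda>w. t w v) x u + br_sum (\<lambda>w. t u w) x v) y
    - cobr_sum (\<lambda>u v. br_sum (\<lambda>w. t w v) y u + br_sum (\<lambda>w. t u w) y v) x"
proof -
  note t = cyc_invariantD[OF t1] cyc_invariantD[OF t2]
  \<comment> \<open>Antisymmetrizing \<open>t\<close> merges the two orders of a pair of cuts, so
    that \<open>k\<close> depends on the unordered pair only.\<close>
  define D where "D u v = t u v - t v u" for u v
  have D_antisym: "D v u = - D u v" for u v
    by (simp add: D_def)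
  have D1: "D (u @ u') v = D (u' @ u) v" and D2: "D v (u @ u') = D v (u' @ u)" for u u' v
    using t by (simp_all add: D_def)
  define k where "k d V e W = g d e * D (d # V @ [e]) (e # W @ [d])" for d V e W
  have k_sym: "k d V e W = k e W d V" for d V e W
    by (simp add: k_def D_antisym[of "d # V @ [e]"] antisym[of e d])
  have k_self: "k a V a W = 0" for a V W
    by (simp add: k_def alt)
  have k1: "k a (X @ [a]) b (Y @ [b]) + k a (b # Y) b (a # X) = 0" for a X b Y
    using D1[of "[a]" "b # Y @ [b]"] D2[of _ "[b]" "a # X @ [a]"]
      D_antisym[of "a # X @ [a, b]" "b # Y @ [b, a]"] by (simp add: k_def)
  have k2: "k a [] b (Y @ b # a # X) + k a (X @ a # b # Y) b [] = 0" for a X b Y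
    using D1[of "a # X @ [a]" "b # Y @ [b]"] D2[of _ "[b]" "[a]"]
      D_antisym[of "[a, b]" "b # Y @ b # a # X @ [a]"] by (simp add: k_def)
  \<comment> \<open>Cuts at a letter \<open>p\<close> of \<open>X\<close> and, in turn, at the first
    \<open>a\<close>, the second \<open>a\<close>, the first \<open>b\<close>, the second
    \<open>b\<close>, or a later letter \<open>q\<close> of \<open>X\<close>.\<close>
  define R where "R a X b Y = split_sum X (\<lambda>X p X'.
    k a X p (X' @ a # b # Y @ [b]) + k p X' a (b # Y @ b # a # X)
    + k p (X' @ [a]) b (Y @ b # a # X) + k p (X' @ a # b # Y) b (a # X)
    + split_sum X' (\<lambda>X' q X''. k p X' q (X'' @ a # b # Y @ b # a # X)))" for a X b Y
  have expand1: "g a b * cobr_sum t (a # X @ a # b # Y @ [b])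
    = g a b * R a X b Y + - (g b a * R b Y a X)
    + split_sum X (\<lambda>X p X'. split_sum Y (\<lambda>Y q Y'.
        g a b * k p (X' @ a # b # Y) q (Y' @ b # a # X)))" for a X b Y
  proof -
    have k: "g d e * t (d # V @ [e]) (e # W @ [d]) + g e d * t (e # W @ [d]) (d # V @ [e])
      = k d V e W" for d V e W
      using antisym[of e d] by (simp add: k_def D_def algebra_simps)
    have s1: "k a (X @ a # b # Y) q (Y' @ [b]) = k q (Y' @ [b]) a (X @ a # b # Y)" for Y q Y'
      by (rule k_sym)
    have s2: "k a (b # Y) q (Y' @ b # a # X) = k q (Y' @ b # a # X) a (b # Y)" for Y q Y'
      by (rule k_sym)
    have "cobr_sum t (a # X @ a # b # Y @ [b]) = R a X b Y + R b Y a X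
      + split_sum X (\<lambda>X p X'. split_sum Y (\<lambda>Y q Y'. k p (X' @ a # b # Y) q (Y' @ b # a # X)))
      + (k a (X @ [a]) b (Y @ [b]) + k a (b # Y) b (a # X))
      + (k a [] b (Y @ b # a # X) + k a (X @ a # b # Y) b [])"
      unfolding cobr_sum_def cyc_sum2_ordered k
      by (simp add: R_def split_sum_add k_self s1 s2 add_ac)
    from this[unfolded k1 k2] show ?thesis
      by (simp add: algebra_simps antisym[of b a] split_sum_mult)
  qed
  have M: "cyc_sum x (\<lambda>a X. cyc_sum y (\<lambda>b Y. split_sum X (\<lambda>X p X'. split_sum Y (\<lambda>Y q Y'.
    g a b * k p (X' @ a # b # Y) q (Y' @ b # a # X))))) = 0"
  proof -
    define U where "U = cyc_sum2 x (\<lambda>a X p X'. cyc_sum2 y (\<lambda>b Y q Y'.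
      g a b * g p q * t (p # X' @ a # b # Y @ [q]) (q # Y' @ b # a # X @ [p])))"
    define U' where "U' = cyc_sum2 x (\<lambda>a X p X'. cyc_sum2 y (\<lambda>b Y q Y'.
      g a b * g p q * t (q # Y' @ b # a # X @ [p]) (p # X' @ a # b # Y @ [q])))"
    \<comment> \<open>Shifting the distinction in both words exchanges the bracketed pair
      \<open>a, b\<close> with the cut pair \<open>p, q\<close>.\<close>
    have "U = U'"
      unfolding U_def U'_def
    proof (subst cyc_sum2_rotate, rule cyc_sum_congs, subst cyc_sum2_rotate, rule cyc_sum_congs)
      fix a X p X' b Y q Y'
      show "g p q * g a b * t (a # X @ p # q # Y' @ [b]) (b # Y @ q # p # X' @ [a])
        = g a b * g p q * t (q # Y' @ b # a # X @ [p]) (p # X' @ a # b # Y @ [q])"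
        using t(1)[of "a # X @ [p]" "q # Y' @ [b]"] t(2)[of _ "b # Y @ [q]" "p # X' @ [a]"]
        by simp
    qed
    moreover have "cyc_sum x (\<lambda>a X. cyc_sum y (\<lambda>b Y. split_sum X (\<lambda>X p X'. split_sum Y (\<lambda>Y q Y'.
      g a b * k p (X' @ a # b # Y) q (Y' @ b # a # X))))) = U - U'"
      unfolding U_def U'_def cyc_sum2_def cyc_sum_split_swap[of y]
      by (simp add: k_def D_def mult.assoc[symmetric] right_diff_distrib split_sum_diff cyc_sum_diff)
    ultimately show ?thesis by simp
  qed
  have R: "cyc_sum x (\<lambda>a X. cyc_sum y (\<lambda>b Y. g a b * R a X b Y))
    = - cobr_sum (\<lambda>u v. br_sum (\<lambda>w. t w v) y u + br_sum (\<lambda>w. t u w) y v) x" for x y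
  proof -
    \<comment> \<open>The letter \<open>b\<close> of \<open>y\<close> pairs with the end
      \<open>a\<close>, the end \<open>c\<close> or an inner letter of the piece
      \<open>a X c\<close>; the antisymmetry of \<open>D\<close> accounts for the other
      piece.\<close>
    define A1 where "A1 = cyc_sum2 x (\<lambda>a X c Z. cyc_sum y (\<lambda>b Y.
      g a c * g b a * D (b # Y @ b # a # X @ [c, a]) (c # Z @ [a])))"
    define A2 where "A2 = cyc_sum2 x (\<lambda>a X c Z. cyc_sum y (\<lambda>b Y.
      g a c * g b c * D (b # Y @ b # c # a # X @ [c]) (c # Z @ [a])))"
    define A3 where "A3 = cyc_sum3 x (\<lambda>a X p X' c Z. cyc_sum y (\<lambda>b Y.
      g a c * g b p * D (b # Y @ b # p # X' @ c # a # X @ [p]) (c # Z @ [a])))"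
    define R1 where "R1 = cyc_sum2 x (\<lambda>a X c Z. cyc_sum y (\<lambda>b Y.
      g a b * k a X c (Z @ a # b # Y @ [b])))"
    define R2 where "R2 = cyc_sum2 x (\<lambda>a X c Z. cyc_sum y (\<lambda>b Y.
      g a b * k c Z a (b # Y @ b # a # X)))"
    define R3 where "R3 = cyc_sum2 x (\<lambda>a X c Z. cyc_sum y (\<lambda>b Y.
      g a b * k c (Z @ [a]) b (Y @ b # a # X)))"
    define R4 where "R4 = cyc_sum2 x (\<lambda>a X c Z. cyc_sum y (\<lambda>b Y.
      g a b * k c (Z @ a # b # Y) b (a # X)))"
    define R5 where "R5 = cyc_sum3 x (\<lambda>a X p X' q Z. cyc_sum y (\<lambda>b Y.
      g a b * k p X' q (Z @ a # b # Y @ b # a # X)))"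
    have br_diff: "br_sum (\<lambda>w. D w v) y u = br_sum (\<lambda>w. t w v) y u - br_sum (\<lambda>w. t v w) y u" for u v
      by (simp add: br_sum_def D_def right_diff_distrib cyc_sum_diff)
    have expand2: "g a c * br_sum (\<lambda>w. D w (c # Z @ [a])) y (a # X @ [c])
      = cyc_sum y (\<lambda>b Y. g a c * g b a * D (b # Y @ b # a # X @ [c, a]) (c # Z @ [a]))
      + cyc_sum y (\<lambda>b Y. g a c * g b c * D (b # Y @ b # c # a # X @ [c]) (c # Z @ [a]))
      + split_sum X (\<lambda>X p X'. cyc_sum y (\<lambda>b Y.
          g a c * g b p * D (b # Y @ b # p # X' @ c # a # X @ [p]) (c # Z @ [a])))" for a X c Z
      unfolding cyc_sum_split_swap[symmetric] cyc_sum_add[symmetric] br_sum_def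
        cyc_sum_mult[symmetric]
      by (simp add: cyc_sum_Cons split_sum_mult mult.assoc, simp add: algebra_simps)
    have "cobr_sum (\<lambda>u v. br_sum (\<lambda>w. t w v) y u + br_sum (\<lambda>w. t u w) y v) x
      = cyc_sum2 x (\<lambda>a X c Z. g a c * br_sum (\<lambda>w. t w (c # Z @ [a])) y (a # X @ [c]))
      + cyc_sum2 x (\<lambda>a X c Z. g a c * br_sum (\<lambda>w. t (a # X @ [c]) w) y (c # Z @ [a]))"
      by (simp add: cobr_sum_def distrib_left cyc_sum2_add)
    also have "cyc_sum2 x (\<lambda>a X c Z. g a c * br_sum (\<lambda>w. t (a # X @ [c]) w) y (c # Z @ [a]))
      = cyc_sum2 x (\<lambda>a X c Z. - (g a c * br_sum (\<lambda>w. t (c # Z @ [a]) w) y (a # X @ [c])))"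
      by (subst cyc_sum2_rotate, intro cyc_sum_congs, subst antisym) simp
    also have "cyc_sum2 x (\<lambda>a X c Z. g a c * br_sum (\<lambda>w. t w (c # Z @ [a])) y (a # X @ [c])) + \<dots>
      = cyc_sum2 x (\<lambda>a X c Z. g a c * br_sum (\<lambda>w. D w (c # Z @ [a])) y (a # X @ [c]))"
      unfolding cyc_sum2_add[symmetric] br_diff by (simp add: right_diff_distrib)
    also have "\<dots> = A1 + A2 + A3"
      unfolding expand2 cyc_sum2_add cyc_sum3_nested A1_def A2_def A3_def ..
    finally have A: "cobr_sum (\<lambda>u v. br_sum (\<lambda>w. t w v) y u + br_sum (\<lambda>w. t u w) y v) x
      = A1 + A2 + A3" .
    have "cyc_sum x (\<lambda>a X. cyc_sum y (\<lambda>b Y. g a b * R a X b Y)) = R1 + R2 + R3 + R4 + R5"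
      unfolding R_def R1_def R2_def R3_def R4_def R5_def cyc_sum3_def cyc_sum2_def
        cyc_sum_add[symmetric] split_sum_add[symmetric] split_sum_mult[symmetric]
        cyc_sum_split_swap[symmetric] distrib_left ..
    moreover have "R1 = - A2"
      unfolding R1_def A2_def cyc_sum2_minus[symmetric] cyc_sum_minus[symmetric]
    proof (subst cyc_sum2_rotate, intro cyc_sum_congs)
      fix a X c Z b Y
      show "g c b * k c Z a (X @ c # b # Y @ [b])
        = - (g a c * g b c * D (b # Y @ b # c # a # X @ [c]) (c # Z @ [a]))"
        using D1[of "b # Y @ [b]" "c # a # X @ [c]"] D1[of "a # X @ [c]" "b # Y @ [b, c]"]
          D_antisym[of "c # Z @ [a]" "a # X @ c # b # Y @ [b, c]"] antisym[of c b] antisym[of c a]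
        by (simp add: k_def)
    qed
    moreover have "R2 = - A1"
      unfolding R2_def A1_def cyc_sum2_minus[symmetric] cyc_sum_minus[symmetric]
    proof (intro cyc_sum_congs)
      fix a X c Z b Y
      show "g a b * k c Z a (b # Y @ b # a # X)
        = - (g a c * g b a * D (b # Y @ b # a # X @ [c, a]) (c # Z @ [a]))"
        using D1[of "[a]" "b # Y @ b # a # X @ [c]"]
          D_antisym[of "c # Z @ [a]" "a # b # Y @ b # a # X @ [c]"] antisym[of a b] antisym[of c a]
        by (simp add: k_def)
    qed
    moreover have "R4 = - R3"
      unfolding R3_def R4_def cyc_sum2_minus[symmetric] cyc_sum_minus[symmetric]
    proof (subst cyc_sum2_rotate, intro cyc_sum_congs)
      fix a X c Z b Y
      show "g c b * k a (X @ c # b # Y) b (c # Z) = - (g a b * k c (Z @ [a]) b (Y @ b # a # X))"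
        using D1[of "a # X @ [c]" "b # Y @ [b]"] D2[of _ "[b]" "c # Z @ [a]"]
          D_antisym[of "c # Z @ [a, b]" "b # Y @ b # a # X @ [c]"]
        by (simp add: k_def)
    qed
    moreover have "R5 = - A3"
    proof -
      have "A3 = - R5"
        unfolding R5_def A3_def cyc_sum3_minus[symmetric] cyc_sum_minus[symmetric]
      proof (subst cyc_sum3_rotate, intro cyc_sum_congs)
        fix a X p X' q Z b Y
        show "g q p * g b a * D (b # Y @ b # a # X @ p # q # Z @ [a]) (p # X' @ [q])
          = - (g a b * k p X' q (Z @ a # b # Y @ b # a # X))"
          using D1[of "q # Z @ [a]" "b # Y @ b # a # X @ [p]"] antisym[of q p] antisym[of b a]
            D_antisym[of "p # X' @ [q]" "q # Z @ a # b # Y @ b # a # X @ [p]"]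
          by (simp add: k_def)
      qed
      then show ?thesis by simp
    qed
    ultimately show ?thesis
      by (simp add: A)
  qed
  have "br_sum (cobr_sum t) x y = cyc_sum x (\<lambda>a X. cyc_sum y (\<lambda>b Y. g a b * R a X b Y))
    - cyc_sum y (\<lambda>b Y. cyc_sum x (\<lambda>a X. g b a * R b Y a X))"
    unfolding br_sum_def expand1 cyc_sum_add cyc_sum_minus M cyc_sum_swap[of y x] by simp
  then show ?thesis by (simp add: R)
qed

end

section \<open>Evaluation of functions on a free module\<close>

definition dual_eval :: "('b \<Rightarrow> 'r) \<Rightarrow> ('b \<Rightarrow>\<^sub>0 'r::comm_ring_1) \<Rightarrow> 'r" where
  "dual_eval \<tau> z = (\<Sum>b\<in>Poly_Mapping.keys z. Poly_Mapping.lookup z b * \<tau> b)"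

lemma dual_eval_superset:
  assumes "finite S" "Poly_Mapping.keys z \<subseteq> S"
  shows "dual_eval \<tau> z = (\<Sum>b\<in>S. Poly_Mapping.lookup z b * \<tau> b)"
  unfolding dual_eval_def by (rule sum.mono_neutral_left[OF assms]) (auto simp: in_keys_iff)

lemma dual_eval_zero [simp]: "dual_eval \<tau> 0 = 0"
  by (simp add: dual_eval_def)

lemma dual_eval_add: "dual_eval \<tau> (x + y) = dual_eval \<tau> x + dual_eval \<tau> y"
  using Poly_Mapping.keys_add[of x y]
  by (subst (1 2 3) dual_eval_superset[of "Poly_Mapping.keys x \<union> Poly_Mapping.keys y"])
     (auto simp: lookup_add sum.distrib algebra_simps)

lemma dual_eval_minus: "dual_eval \<tau> (- x) = - dual_eval \<tau> x"
  using dual_eval_add[of \<tau> x "- x"] by (simp add: add_eq_0_iff)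

lemma dual_eval_diff: "dual_eval \<tau> (x - y) = dual_eval \<tau> x - dual_eval \<tau> y"
  using dual_eval_add[of \<tau> x "- y"] by (simp add: dual_eval_minus)

lemma dual_eval_sum: "dual_eval \<tau> (\<Sum>i\<in>S. f i) = (\<Sum>i\<in>S. dual_eval \<tau> (f i))"
  by (induction S rule: infinite_finite_induct) (simp_all add: dual_eval_add)

lemma dual_eval_scale: "dual_eval \<tau> (scale c x) = c * dual_eval \<tau> x"
  by (subst dual_eval_superset[of "Poly_Mapping.keys x"])
     (auto simp: in_keys_iff dual_eval_def sum_distrib_left mult.assoc)

lemma dual_eval_single [simp]: "dual_eval \<tau> (Poly_Mapping.single b c) = c * \<tau> b"
  by (simp add: dual_eval_def)

lemma dual_eval_lin_ext: "dual_eval \<tau> (lin_ext f z) = dual_eval (\<lambda>b. dual_eval \<tau> (f b)) z"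
  by (simp add: lin_ext_def dual_eval_sum dual_eval_scale) (simp add: dual_eval_def)

lemma dual_eval_tensor:
  "dual_eval \<tau> (x \<otimes> y) = dual_eval (\<lambda>b. dual_eval (\<lambda>c. \<tau> (b, c)) y) x"
  by (simp add: tensor_def dual_eval_sum) (simp add: dual_eval_def sum_distrib_left mult.assoc)

lemma dual_eval_fun_zero [simp]: "dual_eval (\<lambda>_. 0) z = 0"
  by (simp add: dual_eval_def)

lemma dual_eval_fun_add: "dual_eval (\<lambda>b. \<tau> b + \<sigma> b) z = dual_eval \<tau> z + dual_eval \<sigma> z"
  by (simp add: dual_eval_def sum.distrib algebra_simps)

lemma dual_eval_fun_minus: "dual_eval (\<lambda>b. - \<tau> b) z = - dual_eval \<tau> z"
  by (simp add: dual_eval_def sum_negf)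

lemma dual_eval_fun_diff: "dual_eval (\<lambda>b. \<tau> b - \<sigma> b) z = dual_eval \<tau> z - dual_eval \<sigma> z"
  by (simp add: dual_eval_def sum_subtractf algebra_simps)

lemma dual_eval_swap:
  "dual_eval (\<lambda>b. dual_eval (\<lambda>c. f b c) y) x = dual_eval (\<lambda>c. dual_eval (\<lambda>b. f b c) x) y"
  unfolding dual_eval_def sum_distrib_left
  by (subst sum.swap) (simp add: mult.left_commute)

text \<open>Coordinate functions already separate elements, so identities in tensor powers may be
  tested on functionals.\<close>

lemma dual_eval_ext:
  assumes "\<And>\<tau>. dual_eval \<tau> x = dual_eval \<tau> y"
  shows "x = y"
proof (rule poly_mapping_eqI)
  fix b
  have "dual_eval (\<lambda>c. if c = b then 1 else 0) z = Poly_Mapping.lookup z b"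
    for z :: "'a \<Rightarrow>\<^sub>0 'b"
    by (simp add: dual_eval_def if_distrib in_keys_iff cong: if_cong)
  then show "Poly_Mapping.lookup x b = Poly_Mapping.lookup y b"
    using assms[of "\<lambda>c. if c = b then 1 else 0"] by simp
qed

lemma dual_eval_tensor_map:
  "dual_eval \<tau> (tensor_map f g z) = dual_eval (\<lambda>(b, d).
     dual_eval (\<lambda>b'. dual_eval (\<lambda>d'. \<tau> (b', d')) (g (Poly_Mapping.single d 1)))
       (f (Poly_Mapping.single b 1))) z"
  by (simp add: tensor_map_def dual_eval_lin_ext dual_eval_tensor case_prod_unfold)

lemma dual_eval_tensor_swap: "dual_eval \<tau> (tensor_swap z) = dual_eval (\<lambda>(a, b). \<tau> (b, a)) z"
  by (simp add: tensor_swap_def dual_eval_lin_ext case_prod_unfold)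

lemma dual_eval_tensor_cycle:
  "dual_eval \<tau> (tensor_cycle z) = dual_eval (\<lambda>(a, b, c). \<tau> (b, c, a)) z"
  by (simp add: tensor_cycle_def dual_eval_lin_ext case_prod_unfold)

section \<open>Submodules spanned by a set of basis elements\<close>

lemma free_on_zero [simp]: "0 \<in> free_on B"
  by (simp add: free_on_def)

lemma free_on_add: "x \<in> free_on B \<Longrightarrow> y \<in> free_on B \<Longrightarrow> x + y \<in> free_on B"
  using Poly_Mapping.keys_add[of x y] by (auto simp: free_on_def)

lemma free_on_scale: "x \<in> free_on B \<Longrightarrow> scale c x \<in> free_on B"
  by (simp add: free_on_def subset_iff in_keys_iff) (metis mult_zero_right)

text \<open>Membership is asked only for a nonzero coefficient, as words formed at letters with
  pairing 0 need not be paths.\<close>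

lemma free_on_single: "(c \<noteq> 0 \<Longrightarrow> b \<in> B) \<Longrightarrow> Poly_Mapping.single b c \<in> free_on B"
  by (auto simp: free_on_def)

lemma linear_map_on_lin_ext:
  assumes "\<And>a. a \<in> A \<Longrightarrow> f a \<in> free_on B"
  shows "linear_map_on (free_on A) (free_on B) (lin_ext f)"
proof -
  have "lin_ext f x \<in> free_on B" if "x \<in> free_on A" for x
  proof -
    have "(\<Sum>b\<in>S. scale (Poly_Mapping.lookup x b) (f b)) \<in> free_on B" if "finite S" "S \<subseteq> A" for S
      using that by (induction S rule: finite_induct) (auto intro!: free_on_add free_on_scale assms)
    then show ?thesis
      using that by (simp add: lin_ext_def free_on_def)
  qed
  then show ?thesis
    by (simp add: linear_map_on_def lin_ext_add lin_ext_scale)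
qed

lemma split_sum_in_free_on:
  assumes "\<And>u a v. w = u @ a # v \<Longrightarrow> f u a v \<in> free_on B"
  shows "split_sum w f \<in> free_on B"
  by (rule split_sum_induct) (auto intro: free_on_add assms)

section \<open>Transposes of the bracket and the cobracket\<close>

lemma alternating_pairing_pairing: "alternating_pairing (pairing :: 'e + 'e \<Rightarrow> 'e + 'e \<Rightarrow> 'r::comm_ring_1)"
proof
  show "pairing a a = (0::'r)" for a :: "'e + 'e" by (cases a) simp_all
  show "pairing a b = (- pairing b a :: 'r)" for a b :: "'e + 'e" by (cases a; cases b) auto
qed

interpretation pairing: alternating_pairing "pairing :: 'e + 'e \<Rightarrow> 'e + 'e \<Rightarrow> 'r::comm_ring_1"
  by (rule alternating_pairing_pairing)

lemma cyc_sum_conv_nth: "cyc_sum p f = (\<Sum>i<length p. f (p ! i) (drop (Suc i) p @ take i p))"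
  by (simp add: cyc_sum_def split_sum_conv_nth)

lemma rotate_conv_nth: "i < length p \<Longrightarrow> rotate i p = p ! i # drop (Suc i) p @ take i p"
  by (simp add: rotate_drop_take Cons_nth_drop_Suc[symmetric])

lemma br_word_conv_cyc_sum:
  "br_word p q = cyc_sum p (\<lambda>a X. cyc_sum q (\<lambda>b Y.
     Poly_Mapping.single (Cyc (abs_cyclic_word (a # X @ a # b # Y @ [b]))) (pairing a b)))"
  by (auto simp: br_word_def cyc_sum_conv_nth full_turn_def rotate_conv_nth intro!: sum.cong)

text \<open>Once the word is rotated to start at position \<open>i\<close>, the two arc words become
  a prefix and a suffix closed up by \<open>a\<close>.\<close>

lemma cobr_word_conv_cyc_sum:
  fixes p :: "('e + 'e) list"
  shows "(cobr_word p :: ('v, 'e + 'e) cyclic_path \<times> ('v, 'e + 'e) cyclic_path \<Rightarrow>\<^sub>0 'r::comm_ring_1)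
    = scale half (cyc_sum2 p (\<lambda>a X b Y. Poly_Mapping.single
     (Cyc (abs_cyclic_word (a # X @ [b])), Cyc (abs_cyclic_word (b # Y @ [a]))) (pairing a b)))"
proof -
  define F :: "('e + 'e) list \<Rightarrow> ('e + 'e) list \<Rightarrow> 'r \<Rightarrow>
      (('v, 'e + 'e) cyclic_path \<times> ('v, 'e + 'e) cyclic_path \<Rightarrow>\<^sub>0 'r)"
    where "F u v = Poly_Mapping.single (Cyc (abs_cyclic_word u), Cyc (abs_cyclic_word v))" for u v
  define n where "n = length p"
  have "(\<Sum>j<n. F (arc_word p i j) (arc_word p j i) (pairing (p ! i) (p ! j))) =
    split_sum (drop (Suc i) p @ take i p) (\<lambda>X b Y. F (p ! i # X @ [b]) (b # Y @ [p ! i]) (pairing (p ! i) b))"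
    if i: "i < n" for i
  proof -
    define a R where "a = p ! i" and "R = drop (Suc i) p @ take i p"
    have r: "rotate i p = a # R"
      using i by (simp add: rotate_conv_nth n_def a_def R_def)
    have n: "n = Suc (length R)"
      using arg_cong[OF r, of length] by (simp add: n_def)
    \<comment> \<open>The index \<open>j\<close> is replaced by its cyclic distance \<open>l\<close>
      from \<open>i\<close>.\<close>
    have "(\<Sum>j<n. F (arc_word p i j) (arc_word p j i) (pairing a (p ! j)))
      = (\<Sum>l<n. F (arc_word p i ((i + l) mod n)) (arc_word p ((i + l) mod n) i) (pairing a (p ! ((i + l) mod n))))"
      by (rule sum_rotate_index[symmetric])
    also have "\<dots> = (\<Sum>l<n. F (arc_word (a # R) 0 l) (arc_word (a # R) l 0) (pairing a ((a # R) ! l)))"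
    proof (rule sum.cong)
      fix l assume "l \<in> {..<n}"
      then have "l < length p" "0 < length p" by (auto simp: n_def)
      then show "F (arc_word p i ((i + l) mod n)) (arc_word p ((i + l) mod n) i) (pairing a (p ! ((i + l) mod n)))
          = F (arc_word (a # R) 0 l) (arc_word (a # R) l 0) (pairing a ((a # R) ! l))"
        using arc_word_rotate[of 0 p l i] arc_word_rotate[of l p 0 i] nth_rotate[of l p i] i
        by (simp add: r n_def)
    qed simp
    \<comment> \<open>The diagonal term \<open>l = 0\<close> drops out because
      \<open>pairing a a = 0\<close>.\<close>
    also have "\<dots> = (\<Sum>k<length R. F (arc_word (a # R) 0 (Suc k)) (arc_word (a # R) (Suc k) 0)
        (pairing a (R ! k)))"
      unfolding n sum.lessThan_Suc_shift by (simp add: pairing.alt F_def)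
    also have "\<dots> = (\<Sum>k<length R. F (a # take k R @ [R ! k]) (R ! k # drop (Suc k) R @ [a])
        (pairing a (R ! k)))"
    proof (rule sum.cong)
      fix k assume "k \<in> {..<length R}"
      then have k: "k < length R" by simp
      have "arc_word (a # R) 0 (Suc k) = a # take k R @ [R ! k]"
        using k mod_add_self2[of "Suc k" "Suc (length R)"]
        by (simp add: arc_word_def take_Suc_conv_app_nth)
      moreover have "arc_word (a # R) (Suc k) 0 = R ! k # drop (Suc k) R @ [a]"
        using k by (simp add: arc_word_def rotate_drop_take Cons_nth_drop_Suc[symmetric] Suc_diff_Suc)
      ultimately show "F (arc_word (a # R) 0 (Suc k)) (arc_word (a # R) (Suc k) 0) (pairing a (R ! k))
        = F (a # take k R @ [R ! k]) (R ! k # drop (Suc k) R @ [a]) (pairing a (R ! k))"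
        by simp
    qed simp
    finally show ?thesis
      by (simp add: split_sum_conv_nth a_def[symmetric] R_def[symmetric])
  qed
  then show ?thesis
    unfolding cobr_word_def F_def[symmetric] n_def[symmetric] cyc_sum2_def cyc_sum_conv_nth
    by simp
qed

lemma dual_eval_split_sum:
  "dual_eval \<tau> (split_sum w f) = split_sum w (\<lambda>u a v. dual_eval \<tau> (f u a v))"
  by (rule split_sum_hom) (simp_all add: dual_eval_add)

lemma dual_eval_br_word:
  "dual_eval \<tau> (br_word p q) = pairing.br_sum (\<lambda>w. \<tau> (Cyc (abs_cyclic_word w))) p q"
  by (simp add: br_word_conv_cyc_sum pairing.br_sum_def cyc_sum_def dual_eval_split_sum)

lemma dual_eval_cobr_word:
  "dual_eval \<tau> (cobr_word p) =
     half * pairing.cobr_sum (\<lambda>u v. \<tau> (Cyc (abs_cyclic_word u), Cyc (abs_cyclic_word v))) p"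
  by (simp add: cobr_word_conv_cyc_sum pairing.cobr_sum_def cyc_sum2_def cyc_sum_def
      dual_eval_split_sum dual_eval_scale dual_eval_add)

lemma abs_cyclic_word_append_commute: "abs_cyclic_word (u @ v) = abs_cyclic_word (v @ u)"
proof -
  have "rot_equiv (u @ v) (v @ u)"
    unfolding rot_equiv_def by (rule exI[of _ "length u"]) (simp add: rotate_append)
  then show ?thesis
    by (simp add: cyclic_word.abs_eq_iff)
qed

lemma cyc_invariant_abs_cyclic_word [simp]:
  "cyc_invariant (\<lambda>w. f (Cyc (abs_cyclic_word w)))"
  "cyc_invariant (\<lambda>w. g (Cyc (abs_cyclic_word w), c))"
  "cyc_invariant (\<lambda>w. h (c, Cyc (abs_cyclic_word w)))"
  "cyc_invariant (\<lambda>w. k (c, Cyc (abs_cyclic_word w), d))"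
  "cyc_invariant (\<lambda>w. l (c, d, Cyc (abs_cyclic_word w)))"
  unfolding cyc_invariant_def by (intro allI, subst abs_cyclic_word_append_commute, rule refl)+

section \<open>The transposes on cyclic paths, constant paths included\<close>

definition br_dual ::
  "(('v, 'e + 'e) cyclic_path \<Rightarrow> 'r::comm_ring_1) \<Rightarrow> ('v, 'e + 'e) cyclic_path \<Rightarrow>
     ('v, 'e + 'e) cyclic_path \<Rightarrow> 'r" where
  "br_dual \<tau> a b = dual_eval \<tau> (br_plus (Poly_Mapping.single (a, b) 1))"

definition cobr_dual ::
  "(('v, 'e + 'e) cyclic_path \<times> ('v, 'e + 'e) cyclic_path \<Rightarrow> 'r::comm_ring_1) \<Rightarrow>
     ('v, 'e + 'e) cyclic_path \<Rightarrow> 'r" where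
  "cobr_dual \<tau> a = dual_eval \<tau> (cobr_plus (Poly_Mapping.single a 1))"

lemma dual_eval_br_plus:
  "dual_eval \<tau> (br_plus z) = dual_eval (\<lambda>(a, b). br_dual \<tau> a b) z"
  by (auto simp: br_dual_def br_plus_def dual_eval_lin_ext fun_eq_iff
      intro!: arg_cong[where f = "\<lambda>\<tau>. dual_eval \<tau> z"])

lemma dual_eval_br_plus_tensor:
  "dual_eval \<tau> (br_plus (x \<otimes> y)) = dual_eval (\<lambda>a. dual_eval (\<lambda>b. br_dual \<tau> a b) y) x"
  by (simp add: dual_eval_br_plus dual_eval_tensor)

lemma dual_eval_cobr_plus:
  "dual_eval \<tau> (cobr_plus z) = dual_eval (cobr_dual \<tau>) z"
  by (simp add: cobr_dual_def[abs_def] cobr_plus_def dual_eval_lin_ext)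

lemma br_dual_simps [simp]:
  "br_dual \<tau> (Const i) b = 0"
  "br_dual \<tau> a (Const j) = 0"
  "br_dual \<tau> (Cyc (abs_cyclic_word p)) (Cyc (abs_cyclic_word q))
     = pairing.br_sum (\<lambda>w. \<tau> (Cyc (abs_cyclic_word w))) p q"
  by (simp_all add: br_dual_def br_plus_def br_cyclic_word.abs_eq dual_eval_br_word
      split: cyclic_path.split)

lemma cobr_dual_simps [simp]:
  "cobr_dual \<tau> (Const i) = 0"
  "cobr_dual \<tau> (Cyc (abs_cyclic_word p))
     = half * pairing.cobr_sum (\<lambda>u v. \<tau> (Cyc (abs_cyclic_word u), Cyc (abs_cyclic_word v))) p"
  by (simp_all add: cobr_dual_def cobr_plus_def cobr_cyclic_word.abs_eq dual_eval_cobr_word)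

lemma br_dual_zero [simp]: "br_dual (\<lambda>_. 0) a b = 0"
  by (simp add: br_dual_def)

lemma cobr_dual_zero [simp]: "cobr_dual (\<lambda>_. 0) a = 0"
  by (simp add: cobr_dual_def)

text \<open>The representative \<open>p\<close> may be empty; the sums over its positions are then
  empty.\<close>

lemma cyclic_path_cases:
  obtains i where "z = Const i" | p where "z = Cyc (abs_cyclic_word p)"
proof (cases z)
  case (Cyc w)
  moreover have "\<exists>p. w = abs_cyclic_word p"
    by (induction w rule: cyclic_word.abs_induct) auto
  ultimately show ?thesis using that(2) by auto
qed (use that in auto)

lemma br_dual_antisym: "br_dual \<tau> a b = - br_dual \<tau> b a"
  by (cases a rule: cyclic_path_cases; cases b rule: cyclic_path_cases)
     (auto intro: pairing.br_sum_antisym)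

lemma br_dual_jacobi:
  "br_dual (br_dual \<tau> a) b c + br_dual (br_dual \<tau> b) c a + br_dual (br_dual \<tau> c) a b = 0"
  by (cases a rule: cyclic_path_cases; cases b rule: cyclic_path_cases;
      cases c rule: cyclic_path_cases) (simp_all add: pairing.br_sum_jacobi)

lemma cobr_dual_antisym: "cobr_dual (\<lambda>(u, v). \<tau> (v, u)) a = - cobr_dual \<tau> a"
  by (cases a rule: cyclic_path_cases)
     (simp_all add: pairing.cobr_sum_antisym[of "\<lambda>u v. \<tau> (Cyc (abs_cyclic_word u), Cyc (abs_cyclic_word v))"])

lemma cobr_dual_cojacobi:
  fixes \<tau> :: "('v, 'e + 'e) cyclic_path \<times> ('v, 'e + 'e) cyclic_path \<times> ('v, 'e + 'e) cyclic_path
    \<Rightarrow> 'r::comm_ring_1"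
  shows "cobr_dual (\<lambda>(u, z). cobr_dual (\<lambda>(v, w). \<tau> (u, v, w)) z) a
    + cobr_dual (\<lambda>(u, z). cobr_dual (\<lambda>(v, w). \<tau> (v, w, u)) z) a
    + cobr_dual (\<lambda>(u, z). cobr_dual (\<lambda>(v, w). \<tau> (w, u, v)) z) a = 0"
proof (cases a rule: cyclic_path_cases)
  case (2 p)
  let ?C = "\<lambda>w. Cyc (abs_cyclic_word w) :: ('v, 'e + 'e) cyclic_path"
  show ?thesis
    using pairing.cobr_sum_cojacobi[of "\<lambda>u v w. \<tau> (?C u, ?C v, ?C w)" p]
    by (simp add: 2 pairing.cobr_sum_mult distrib_left[symmetric] mult.assoc)
qed simp

lemma cobr_br_dual:
  "br_dual (cobr_dual \<tau>) a b
    = cobr_dual (\<lambda>(u, v). br_dual (\<lambda>w. \<tau> (w, v)) a u + br_dual (\<lambda>w. \<tau> (u, w)) a v) b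
    - cobr_dual (\<lambda>(u, v). br_dual (\<lambda>w. \<tau> (w, v)) b u + br_dual (\<lambda>w. \<tau> (u, w)) b v) a"
  by (cases a rule: cyclic_path_cases; cases b rule: cyclic_path_cases)
     (simp_all add: pairing.br_sum_mult pairing.cobr_br_sum right_diff_distrib)

lemma br_cobr_dual:
  assumes "(2::'r::comm_ring_1) dvd 1"
  shows "cobr_dual (\<lambda>(u, v). br_dual \<tau> u v :: 'r) a = 0"
proof (cases a rule: cyclic_path_cases)
  case (2 p)
  let ?t = "\<lambda>w. \<tau> (Cyc (abs_cyclic_word w))"
  \<comment> \<open>Writing 1 as \<open>half * 2\<close> removes the 2 from
    \<open>pairing.br_cobr_sum\<close>.\<close>
  have "pairing.cobr_sum (pairing.br_sum ?t) p = half * (2 * pairing.cobr_sum (pairing.br_sum ?t) p)"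
    using two_half[OF assms] by (simp only: mult.assoc[symmetric] mult.commute[of half 2] mult_1)
  also have "\<dots> = 0"
    by (simp only: pairing.br_cobr_sum cyc_invariant_abs_cyclic_word mult_zero_right)
  finally show ?thesis by (simp add: 2)
qed simp

section \<open>Closure under the operations\<close>

lemma wf_digraph_double:
  assumes "wf_digraph Q"
  shows "wf_digraph (double Q)"
  using assms by (auto simp: wf_digraph_def double_def)

text \<open>A nonzero pairing means mutually reverse arrows; their interchanged ends are what makes
  the output words closed walks.\<close>

lemma pairing_nonzero_ends:
  assumes "pairing a b \<noteq> (0 :: 'r::comm_ring_1)"
  shows "head (double Q) a = tail (double Q) b" "tail (double Q) a = head (double Q) b"
  using assms by (cases a; cases b; auto simp: double_def split: if_splits)+

context
  fixes Q :: "('v, 'e) pre_digraph"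
  assumes wf: "wf_digraph Q"
begin

interpretation D: wf_digraph "double Q"
  by (rule wf_digraph_double[OF wf])

lemma awalk_rotate:
  assumes "D.awalk x (u @ a # v) x"
  shows "a \<in> arcs (double Q)" "D.awalk (head (double Q) a) (v @ u) (tail (double Q) a)"
  using assms by (auto simp: D.awalk_Cons_iff)

lemma Cyc_in_cyclic_paths:
  assumes "D.awalk x p x" "p \<noteq> []"
  shows "Cyc (abs_cyclic_word p) \<in> cyclic_paths (double Q)"
  using assms by (auto simp: cyclic_paths_def)

lemma in_cyclic_pathsE:
  assumes "z \<in> cyclic_paths (double Q)"
  obtains i where "z = Const i" | p x where "z = Cyc (abs_cyclic_word p)" "D.awalk x p x"
  using assms by (auto simp: cyclic_paths_def)

lemma br_word_in_free_on:
  assumes "D.awalk x p x" "D.awalk y q y"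
  shows "(br_word p q :: ('v, 'e + 'e) cyclic_path \<Rightarrow>\<^sub>0 'r::comm_ring_1)
    \<in> free_on (cyclic_paths (double Q))"
  unfolding br_word_conv_cyc_sum cyc_sum_def
proof (intro split_sum_in_free_on free_on_single Cyc_in_cyclic_paths)
  fix u a v u' b v'
  assume p: "p = u @ a # v" and q: "q = u' @ b # v'" and ab: "pairing a b \<noteq> (0::'r)"
  show "D.awalk (tail (double Q) a) (a # (v @ u) @ a # b # (v' @ u') @ [b]) (tail (double Q) a)"
    using awalk_rotate[OF assms(1)[unfolded p]] awalk_rotate[OF assms(2)[unfolded q]]
      pairing_nonzero_ends[OF ab, of Q]
    by (auto simp: D.awalk_simps)
qed simp

lemma cobr_word_in_free_on:
  assumes "D.awalk x p x"
  shows "(cobr_word p :: ('v, 'e + 'e) cyclic_path \<times> ('v, 'e + 'e) cyclic_path \<Rightarrow>\<^sub>0 'r::comm_ring_1)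
    \<in> free_on (cyclic_paths (double Q) \<times> cyclic_paths (double Q))"
  unfolding cobr_word_conv_cyc_sum cyc_sum2_def cyc_sum_def
proof (intro free_on_scale split_sum_in_free_on free_on_single SigmaI)
  fix u a v X b Y
  assume p: "p = u @ a # v" and vu: "v @ u = X @ b # Y" and ab: "pairing a b \<noteq> (0::'r)"
  note w = awalk_rotate[OF assms[unfolded p], unfolded vu] pairing_nonzero_ends[OF ab, of Q]
  show "Cyc (abs_cyclic_word (a # X @ [b])) \<in> cyclic_paths (double Q)"
    using w by (intro Cyc_in_cyclic_paths[of "tail (double Q) a"]) (auto simp: D.awalk_simps)
  show "Cyc (abs_cyclic_word (b # Y @ [a])) \<in> cyclic_paths (double Q)"
    using w by (intro Cyc_in_cyclic_paths[of "tail (double Q) b"]) (auto simp: D.awalk_simps)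
qed

lemma linear_br_plus:
  "linear_map_on (free_on (cyclic_paths (double Q) \<times> cyclic_paths (double Q)))
    (free_on (cyclic_paths (double Q)))
    (br_plus :: (('v, 'e + 'e) cyclic_path \<times> ('v, 'e + 'e) cyclic_path \<Rightarrow>\<^sub>0 'r::comm_ring_1) \<Rightarrow> _)"
  unfolding br_plus_def
  by (intro linear_map_on_lin_ext)
     (auto elim!: in_cyclic_pathsE simp: br_cyclic_word.abs_eq intro: br_word_in_free_on)

lemma linear_cobr_plus:
  "linear_map_on (free_on (cyclic_paths (double Q)))
    (free_on (cyclic_paths (double Q) \<times> cyclic_paths (double Q)))
    (cobr_plus :: (('v, 'e + 'e) cyclic_path \<Rightarrow>\<^sub>0 'r::comm_ring_1) \<Rightarrow> _)"
  unfolding cobr_plus_def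
  by (intro linear_map_on_lin_ext)
     (auto elim!: in_cyclic_pathsE simp: cobr_cyclic_word.abs_eq intro: cobr_word_in_free_on)

end

section \<open>The involutive Lie bialgebra\<close>

text \<open>The sum over \<open>x\<close> is moved outside to match
  \<open>cobr_br_dual\<close>.\<close>

lemma dual_eval_adjoint_action:
  "dual_eval \<tau> (adjoint_action br_plus x z) = dual_eval (\<lambda>a. dual_eval (\<lambda>(u, v).
     br_dual (\<lambda>w. \<tau> (w, v)) a u + br_dual (\<lambda>w. \<tau> (u, w)) a v) z) x"
  by (simp add: adjoint_action_def dual_eval_add dual_eval_tensor_map dual_eval_br_plus_tensor
      case_prod_unfold dual_eval_fun_add[symmetric] dual_eval_swap[of _ x z])

lemma dual_eval_tensor_map_cobr:
  "dual_eval \<tau> (tensor_map id cobr_plus z)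
    = dual_eval (\<lambda>(u, y). cobr_dual (\<lambda>(v, w). \<tau> (u, v, w)) y) z"
  by (simp add: dual_eval_tensor_map cobr_dual_def case_prod_unfold)

theorem proposition4p1:
  fixes Q :: "('v, 'e) pre_digraph"
  assumes "fin_digraph Q"
    and "(2::'r::comm_ring_1) dvd 1"
  shows "involutive_lie_bialgebra_on (cyclic_paths (double Q))
    (br_plus :: (('v, 'e + 'e) cyclic_path \<times> ('v, 'e + 'e) cyclic_path \<Rightarrow>\<^sub>0 'r) \<Rightarrow> _)
    cobr_plus"
proof unfold_locales
  let ?N = "free_on (cyclic_paths (double Q)) :: (('v, 'e + 'e) cyclic_path \<Rightarrow>\<^sub>0 'r) set"
  have wf: "wf_digraph Q"
    using assms(1) by (rule fin_digraph.axioms(1))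
  show "linear_map_on (free_on (cyclic_paths (double Q) \<times> cyclic_paths (double Q))) ?N br_plus"
    by (rule linear_br_plus[OF wf])
  show "linear_map_on ?N (free_on (cyclic_paths (double Q) \<times> cyclic_paths (double Q))) cobr_plus"
    by (rule linear_cobr_plus[OF wf])
  fix x y z :: "('v, 'e + 'e) cyclic_path \<Rightarrow>\<^sub>0 'r"
  show "br_plus (x \<otimes> x) = 0"
  proof (rule dual_eval_ext)
    fix \<tau>
    \<comment> \<open>Interchanging the two sums shows \<open>S = - S\<close>; invertibility of 2
      then gives the alternating law.\<close>
    define S where "S = dual_eval (\<lambda>a. dual_eval (\<lambda>b. br_dual \<tau> a b) x) x"
    have "S = dual_eval (\<lambda>a. dual_eval (\<lambda>b. - br_dual \<tau> b a) x) x"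
      unfolding S_def
      by (intro arg_cong[where f = "\<lambda>f. dual_eval f x"] ext) (rule br_dual_antisym)
    also have "\<dots> = - S"
      by (simp add: S_def dual_eval_fun_minus) (subst dual_eval_swap, rule refl)
    finally have "2 * S = 0" by (metis add.right_inverse mult_2)
    then have "half * 2 * S = 0" by (simp add: mult.assoc)
    then have "S = 0"
      using two_half[OF assms(2)] by (simp add: mult.commute)
    then show "dual_eval \<tau> (br_plus (x \<otimes> x)) = dual_eval \<tau> 0"
      by (simp add: S_def dual_eval_br_plus_tensor)
  qed
  show "br_plus (x \<otimes> br_plus (y \<otimes> z)) + br_plus (y \<otimes> br_plus (z \<otimes> x))
    + br_plus (z \<otimes> br_plus (x \<otimes> y)) = 0"
  proof (rule dual_eval_ext)
    fix \<tau> :: "('v, 'e + 'e) cyclic_path \<Rightarrow> 'r"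
    let ?J = "\<lambda>a b c. br_dual (br_dual \<tau> a) b c"
    have J: "dual_eval \<tau> (br_plus (x \<otimes> br_plus (y \<otimes> z)))
      = dual_eval (\<lambda>a. dual_eval (\<lambda>b. dual_eval (\<lambda>c. ?J a b c) z) y) x" for x y z
      by (simp add: dual_eval_br_plus_tensor)
    \<comment> \<open>The other two terms are brought to the summation order \<open>x\<close>,
      \<open>y\<close>, \<open>z\<close>, so that \<open>br_dual_jacobi\<close> applies under the
      sums.\<close>
    have "dual_eval (\<lambda>b. dual_eval (\<lambda>c. dual_eval (\<lambda>a. ?J b c a) x) z) y
        = dual_eval (\<lambda>a. dual_eval (\<lambda>b. dual_eval (\<lambda>c. ?J b c a) z) y) x"
      by (simp only: dual_eval_swap[of _ x z] dual_eval_swap[of _ x y])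
    moreover have "dual_eval (\<lambda>c. dual_eval (\<lambda>a. dual_eval (\<lambda>b. ?J c a b) y) x) z
        = dual_eval (\<lambda>a. dual_eval (\<lambda>b. dual_eval (\<lambda>c. ?J c a b) z) y) x"
      by (simp only: dual_eval_swap[of _ x z] dual_eval_swap[of _ y z])
    ultimately show "dual_eval \<tau> (br_plus (x \<otimes> br_plus (y \<otimes> z)) + br_plus (y \<otimes> br_plus (z \<otimes> x))
        + br_plus (z \<otimes> br_plus (x \<otimes> y))) = dual_eval \<tau> 0"
      by (simp add: dual_eval_add J dual_eval_fun_add[symmetric] br_dual_jacobi)
  qed
  show "tensor_swap (cobr_plus x) = - cobr_plus x"
    by (rule dual_eval_ext)
       (simp add: dual_eval_tensor_swap dual_eval_cobr_plus dual_eval_minus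
          cobr_dual_antisym[abs_def] dual_eval_fun_minus)
  show "tensor_map id cobr_plus (cobr_plus x) + tensor_cycle (tensor_map id cobr_plus (cobr_plus x))
    + tensor_cycle (tensor_cycle (tensor_map id cobr_plus (cobr_plus x))) = 0"
    by (rule dual_eval_ext)
       (simp add: dual_eval_add dual_eval_tensor_cycle dual_eval_tensor_map_cobr
          dual_eval_cobr_plus dual_eval_fun_add[symmetric] cobr_dual_cojacobi)
  show "cobr_plus (br_plus (x \<otimes> y))
    = adjoint_action br_plus x (cobr_plus y) - adjoint_action br_plus y (cobr_plus x)"
    by (rule dual_eval_ext)
       (simp add: dual_eval_diff dual_eval_adjoint_action dual_eval_cobr_plus
          dual_eval_br_plus_tensor cobr_br_dual dual_eval_fun_diff dual_eval_swap[of _ x y])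
  show "br_plus (cobr_plus x) = 0"
    by (rule dual_eval_ext)
       (simp add: dual_eval_br_plus dual_eval_cobr_plus br_cobr_dual[OF assms(2), abs_def])
qed

end
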